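(* Let $k\ge2$ and let $N_1\ge\cdots\ge N_{k-1}\ge0$ be integers. For $1\le a\le k$ let $\overline{E}^{NSE}_{N_1,\ldots,N_{k-1};a}(n)$ (resp. $\overline{E}^{NESE}_{N_1,\ldots,N_{k-1};a}(n)$) be the number of lattice paths with major index $n$ satisfying the special $(k,a)$-conditions, whose leftmost peak is an NSE peak (resp. an NESE peak), and which have exactly $N_r$ peaks of relative height $\ge r$ for each $r=1,\dots,k-1$. Then for $2\le a\le k$, \[\overline{E}^{NESE}_{N_1,\ldots,N_{k-1};a}(n)=\overline{E}^{NSE}_{N_1,\ldots,N_{k-1};a-1}(n),\] and \[\overline{E}^{NESE}_{N_1,\ldots,N_{k-1};1}(n)=\overline{E}^{NSE}_{N_1,\ldots,N_{k-1};k-1}(n-N_1-N_2-\cdots-N_{k-1}).\]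
   Context: Lattice paths: paths in the first quadrant starting on the $y$-axis and ending on the $x$-axis, with unit steps NE $(x,y)\to(x+1,y+1)$, SE $(x,y)\to(x+1,y-1)$, N $(x,y-1)\to(x,y)$, E $(x,0)\to(x+1,0)$ (only at height $0$). Weight = $x$-coordinate. A peak is a vertex preceded by NE (NESE peak) or N (NSE peak) and followed by SE. Paths are empty or end with SE; as stated in the paper, if the leftmost peak is an NSE peak, the path must start with an NE step, except when it starts at $(0,0)$ with an E step. Major index = sum of weights of peaks. Special $(k,a)$-conditions: start at height $k-a$, all heights $<k$. Relative height of a peak $(x,y)$: largest $h$ with vertices $(x',y-h),(x'',y-h)$ on the path, $x'\le x<x''$, such that between them no peak has height $>y$ and every peak of height $y$ has abscissa $\ge x$. Counts at negative arguments are $0$.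
   Formalization: Two corrections to the lattice paths: a path whose leftmost peak is an NSE peak must start with an SE step (not NE), except from (0,0) with an E step; and an N step may occur only directly before an SE step. Without them the identities fail. *)

theory Defs
  imports Main
begin

datatype step = NorthEast | SouthEast | North | East

fun move :: "step \<Rightarrow> int \<times> int \<Rightarrow> int \<times> int" where
  "move NorthEast (x, y) = (x + 1, y + 1)"
| "move SouthEast (x, y) = (x + 1, y - 1)"
| "move North (x, y) = (x, y + 1)"
| "move East (x, y) = (x + 1, y)"

(* A path is given by the height of its starting point on the y-axis and the list of its
   steps; it visits vertex p 0, ..., vertex p (path_length p). *)
type_synonym path = "int \<times> step list"

abbreviation start_height :: "path \<Rightarrow> int" where "start_height \<equiv> fst"
abbreviation steps :: "path \<Rightarrow> step list" where "steps \<equiv> snd"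
abbreviation path_length :: "path \<Rightarrow> nat" where "path_length p \<equiv> length (steps p)"

definition vertex :: "path \<Rightarrow> nat \<Rightarrow> int \<times> int" where
  "vertex p i = fold move (take i (steps p)) (0, start_height p)"

definition weight :: "path \<Rightarrow> nat \<Rightarrow> int" where
  "weight p i = fst (vertex p i)"

definition height :: "path \<Rightarrow> nat \<Rightarrow> int" where
  "height p i = snd (vertex p i)"

(* Vertices are referred to by their index: vertex i lies between step i - 1 and step i. *)
definition NESE_peaks :: "path \<Rightarrow> nat set" where
  "NESE_peaks p =
     {i. 0 < i \<and> i < path_length p \<and> steps p ! (i - 1) = NorthEast \<and> steps p ! i = SouthEast}"

definition NSE_peaks :: "path \<Rightarrow> nat set" where
  "NSE_peaks p =
     {i. 0 < i \<and> i < path_length p \<and> steps p ! (i - 1) = North \<and> steps p ! i = SouthEast}"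

definition peaks :: "path \<Rightarrow> nat set" where
  "peaks p = NESE_peaks p \<union> NSE_peaks p"

definition is_leftmost_peak :: "path \<Rightarrow> nat \<Rightarrow> bool" where
  "is_leftmost_peak p i \<longleftrightarrow> i \<in> peaks p \<and> (\<forall>j \<in> peaks p. weight p i \<le> weight p j)"

(* A North step occurs only as the ascending step of an NSE peak, i.e. directly before a
   South-East step.

   If the leftmost peak is an NSE peak, the path must begin with a South-East step, or, when
   it begins at the origin, with an East step.  The source prints "NE" instead of "SE" here.
   That is a misprint: with "NE" and k = 2, no path of height < 2 starting at (0,1) has an
   NSE peak as leftmost peak, so both identities would fail; for instance NE, SE is an
   NESE path from (0,0) of major index 1, and its counterpart is SE, N, SE from (0,1). *)
definition lattice_path :: "path \<Rightarrow> bool" where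
  "lattice_path p \<longleftrightarrow>
     (\<forall>i \<le> path_length p. 0 \<le> height p i) \<and>
     height p (path_length p) = 0 \<and>
     (\<forall>i < path_length p. steps p ! i = East \<longrightarrow> height p i = 0) \<and>
     (\<forall>i < path_length p. steps p ! i = North \<longrightarrow>
        Suc i < path_length p \<and> steps p ! Suc i = SouthEast) \<and>
     (steps p = [] \<or> last (steps p) = SouthEast) \<and>
     (\<forall>i. is_leftmost_peak p i \<and> i \<in> NSE_peaks p \<longrightarrow>
        hd (steps p) = SouthEast \<or> (start_height p = 0 \<and> hd (steps p) = East))"

definition major_index :: "path \<Rightarrow> int" where
  "major_index p = (\<Sum>i \<in> peaks p. weight p i)"

definition special_conditions :: "nat \<Rightarrow> nat \<Rightarrow> path \<Rightarrow> bool" where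
  "special_conditions k a p \<longleftrightarrow>
     start_height p = int k - int a \<and> (\<forall>i \<le> path_length p. height p i < int k)"

definition vertices :: "path \<Rightarrow> (int \<times> int) set" where
  "vertices p = vertex p ` {..path_length p}"

(* The set below is finite, and it contains 1 when i is a peak of a lattice path (the two
   witnesses are then the neighbours of the peak), so Max is its largest element. *)
definition relative_height :: "path \<Rightarrow> nat \<Rightarrow> int" where
  "relative_height p i =
     Max {h. \<exists>x' x''. (x', height p i - h) \<in> vertices p \<and> (x'', height p i - h) \<in> vertices p \<and>
               x' \<le> weight p i \<and> weight p i < x'' \<and>
               (\<forall>j \<in> peaks p. x' \<le> weight p j \<and> weight p j \<le> x'' \<longrightarrow>
                  height p j \<le> height p i \<and>
                  (height p j = height p i \<longrightarrow> weight p i \<le> weight p j))}"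

definition has_peak_numbers :: "nat \<Rightarrow> (nat \<Rightarrow> nat) \<Rightarrow> path \<Rightarrow> bool" where
  "has_peak_numbers k N p \<longleftrightarrow>
     (\<forall>r \<in> {1..k - 1}. card {i \<in> peaks p. int r \<le> relative_height p i} = N r)"

definition E_NSE :: "nat \<Rightarrow> (nat \<Rightarrow> nat) \<Rightarrow> nat \<Rightarrow> int \<Rightarrow> nat" where
  "E_NSE k N a n = card {p. lattice_path p \<and> special_conditions k a p \<and> major_index p = n \<and>
     (\<exists>i. is_leftmost_peak p i \<and> i \<in> NSE_peaks p) \<and> has_peak_numbers k N p}"

definition E_NESE :: "nat \<Rightarrow> (nat \<Rightarrow> nat) \<Rightarrow> nat \<Rightarrow> int \<Rightarrow> nat" where
  "E_NESE k N a n = card {p. lattice_path p \<and> special_conditions k a p \<and> major_index p = n \<and>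
     (\<exists>i. is_leftmost_peak p i \<and> i \<in> NESE_peaks p) \<and> has_peak_numbers k N p}"

lemma weight_nonneg: "0 \<le> weight p i"
proof -
  have "fst v \<le> fst (fold move ss v)" for ss v
  proof (induction ss arbitrary: v)
    case (Cons s ss)
    have "fst v \<le> fst (move s v)"
      by (cases s; cases v) auto
    with Cons show ?case by (metis fold_simps(2) order_trans)
  qed simp
  from this[of "(0, start_height p)"] show ?thesis
    by (simp add: weight_def vertex_def)
qed

lemma major_index_nonneg: "0 \<le> major_index p"
  unfolding major_index_def by (simp add: sum_nonneg weight_nonneg)

(* The counts at negative arguments are 0 without any further convention. *)
lemma counts_negative:
  assumes "n < 0"
  shows "E_NSE k N a n = 0" and "E_NESE k N a n = 0"
proof -
  have "major_index p \<noteq> n" for p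
    using major_index_nonneg[of p] assms by linarith
  then show "E_NSE k N a n = 0" and "E_NESE k N a n = 0"
    by (simp_all add: E_NSE_def E_NESE_def)
qed

end

theory Submission
  imports Defs
begin

text \<open>
  Turning the first NESE peak of a path from height \<open>k - a\<close> into an NSE peak and putting a
  South-East step in front gives a path from height \<open>k - a + 1\<close> whose peaks are at the same
  points; this is the first identity.  By its case \<open>a = k\<close>, the second one compares NESE paths
  from height \<open>k - 1\<close> with NESE paths from height 0.  Replacing North by North-East steps shifts
  the major index by an amount that depends only on which peaks are NSE peaks, so that it suffices
  to consider paths without North steps.

  Deleting all factors NE SE of such a path at once lowers the relative height of each peak
  by one, hence the numbers \<open>N\<^sub>1, N\<^sub>2, \<dots>\<close> become \<open>N\<^sub>2, N\<^sub>3, \<dots>\<close>.  The deleted factors form a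
  multiset of \<open>N\<^sub>1\<close> gaps of the shortened path that contains all its peaks, and the \<open>N\<^sub>1 - N\<^sub>2\<close>
  remaining gaps are arbitrary.  The major index drops by \<open>N\<^sub>1\<^sup>2\<close> plus the sum of the abscissas of
  these remaining gaps, whatever the shortened path is.  So a bijection for \<open>k - 1\<close> lifts to one
  between the paths from height 0 and those from height \<open>k - 2\<close>, which raises the major index by
  \<open>N\<^sub>2 + \<dots> + N\<^bsub>k-1\<^esub>\<close>.  A path from height \<open>k - 1\<close> is a South-East step followed by a path from
  height \<open>k - 2\<close>, which contributes the missing \<open>N\<^sub>1\<close>.
\<close>

section \<open>Words and deletion of peaks\<close>

fun rise :: "step \<Rightarrow> int" where
  "rise NorthEast = 1"
| "rise SouthEast = - 1"
| "rise North = 1"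
| "rise East = 0"

fun run :: "step \<Rightarrow> int" where
  "run NorthEast = 1"
| "run SouthEast = 1"
| "run North = 0"
| "run East = 1"

text \<open>Only the heights of a walk read from right to left matter, and no step goes vertically
  down, so \<open>SouthEast\<close> stands for a reversed \<open>North\<close>.\<close>

fun flip :: "step \<Rightarrow> step" where
  "flip NorthEast = SouthEast"
| "flip SouthEast = NorthEast"
| "flip North = SouthEast"
| "flip East = East"

lemma rise_flip [simp]: "rise (flip x) = - rise x"
  by (cases x) auto

fun descends :: "step list \<Rightarrow> bool" where
  "descends [] \<longleftrightarrow> False"
| "descends (x # w) \<longleftrightarrow> x = SouthEast"

lemma descends_append [simp]: "descends (v @ w) \<longleftrightarrow> (if v = [] then descends w else descends v)"
  by (cases v) auto

lemma descendsE:
  assumes "descends w"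
  obtains w' where "w = SouthEast # w'"
  using assms by (cases w) auto

text \<open>Unlike a lattice path, a path word may end with East steps, because deleting a peak at
  the end can expose them.\<close>

fun path_word :: "int \<Rightarrow> int \<Rightarrow> step list \<Rightarrow> bool" where
  "path_word k s [] \<longleftrightarrow> s = 0 \<and> 0 < k"
| "path_word k s (x # w) \<longleftrightarrow> 0 \<le> s \<and> s < k \<and> (x = East \<longrightarrow> s = 0) \<and>
     (x = North \<longrightarrow> descends w) \<and> path_word k (s + rise x) w"

text \<open>Keeps from \<open>path_word\<close> only what survives reversal, so that suffixes and
  reversed prefixes can be treated alike.\<close>

fun grounded :: "int \<Rightarrow> step list \<Rightarrow> bool" where
  "grounded s [] \<longleftrightarrow> 0 \<le> s"
| "grounded s (x # w) \<longleftrightarrow> 0 \<le> s \<and> (x = East \<longrightarrow> s = 0) \<and> grounded (s + rise x) w"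

lemma path_word_grounded: "path_word k s w \<Longrightarrow> grounded s w"
  by (induction w arbitrary: s) auto

lemma grounded_nonneg: "grounded s w \<Longrightarrow> 0 \<le> s"
  by (cases w) auto

text \<open>Walking along the word, depth \<open>a\<close> below the start is reached before any later vertex
  reaches level \<open>b\<close>.\<close>

fun sinks :: "int \<Rightarrow> int \<Rightarrow> step list \<Rightarrow> bool" where
  "sinks a b [] \<longleftrightarrow> a \<le> 0"
| "sinks a b (x # w) \<longleftrightarrow> a \<le> 0 \<or> (rise x < b \<and> sinks (a + rise x) (b - rise x) w)"

lemma sinks_nonpos: "a \<le> 0 \<Longrightarrow> sinks a b w"
  by (cases w) auto

text \<open>Serves mostly to exclude East steps: these lie at height 0, from where no positive depth
  can be reached.\<close>

lemma sinks_le: "\<lbrakk>grounded s w; sinks a b w\<rbrakk> \<Longrightarrow> a \<le> s"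
  by (induction w arbitrary: s a b) (auto, force+)

lemma sinks_snoc_NE [simp]: "sinks a b (w @ [NorthEast]) \<longleftrightarrow> sinks a b w"
  by (induction w arbitrary: a b) auto

text \<open>The vertex between a prefix and the suffix \<open>w\<close> is a peak of relative height at least \<open>r\<close>.
  Here \<open>v\<close> is the prefix read from right to left with slopes reversed, so that both conditions
  describe walks leaving the vertex; the bounds 0 and 1 say that an equally high peak is
  allowed on the right but not on the left.\<close>

definition gap_peak :: "int \<Rightarrow> step list \<Rightarrow> step list \<Rightarrow> bool" where
  "gap_peak r v w \<longleftrightarrow> sinks r 0 v \<and> sinks r 1 w"

fun peak_count :: "int \<Rightarrow> step list \<Rightarrow> step list \<Rightarrow> nat" where
  "peak_count r v [] = of_bool (gap_peak r v [])"
| "peak_count r v (x # w) = of_bool (gap_peak r v (x # w)) + peak_count r (flip x # v) w"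

text \<open>Deletes the factors NE SE (bumps) in a single pass. A factor that arises only through
  the deletion is kept, being what remains of a peak of relative height at least 2.\<close>

function cut_peaks :: "step list \<Rightarrow> step list" where
  "cut_peaks [] = []"
| "cut_peaks (x # w) = (if x = NorthEast \<and> descends w then cut_peaks (tl w) else x # cut_peaks w)"
  by pat_completeness auto
termination by (relation "measure length") (auto simp: less_Suc_eq_le)

lemma grounded_cut_peaks: "grounded s w \<Longrightarrow> grounded s (cut_peaks w)"
  by (induction w arbitrary: s rule: cut_peaks.induct) (auto elim!: descendsE)

text \<open>Off the ground, every ascent ends in the top of a deleted bump, so deletion lowers the
  bound on the heights by exactly one. Depths are unaffected, since a bump has no vertex below its
  base.\<close>

lemma sinks_cut_peaks:
  assumes "grounded s w" "1 \<le> a" "1 \<le> b" "North \<notin> set w"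
  shows "sinks a (b + 1) w \<longleftrightarrow> sinks a b (cut_peaks w)"
  using assms
proof (induction w arbitrary: s a b rule: cut_peaks.induct)
  case 1
  then show ?case by simp
next
  case (2 x w)
  show ?case
  proof (cases "x = NorthEast \<and> descends w")
    case True
    then obtain w' where w': "w = SouthEast # w'" by (auto elim: descendsE)
    then show ?thesis using 2(1)[OF True, of s a b] 2(3-) True by simp
  next
    case False
    note IH = 2(2)[OF False]
    show ?thesis
    proof (cases x)
      case SouthEast
      show ?thesis
      proof (cases "a = 1")
        case True
        then show ?thesis using SouthEast 2(3-) by (simp add: sinks_nonpos)
      next
        case False
        then show ?thesis using SouthEast 2(3-) IH[of "s - 1" "a - 1" "b + 1"] by (simp add: add.commute)
      qed
    next
      case East
      then have "s = 0" using 2(3) by simp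
      then have "\<not> sinks a (b + 1) (x # w)" "\<not> sinks a b (cut_peaks (x # w))"
        using sinks_le[OF 2(3)] sinks_le[OF grounded_cut_peaks[OF 2(3)]] 2(4) by fastforce+
      then show ?thesis by simp
    next
      case North
      then show ?thesis using 2(6) by simp
    next
      case NorthEast
      show ?thesis
      proof (cases "b = 1")
        case True
        \<comment> \<open>An undeleted NE is followed by a second NE, unless the word ends, so it
          breaks the bound 2 in \<open>w\<close>; in the shortened word it already breaks the bound
          1.\<close>
        have "\<not> sinks (a + 1) 1 w"
        proof (cases w)
          case Nil
          then show ?thesis using 2(4) by simp
        next
          case (Cons y v)
          then have "y = NorthEast" using NorthEast 2(3,6) False by (cases y) auto
          then show ?thesis using Cons 2(4) by simp
        qed
        then show ?thesis using True NorthEast False 2(4) by simp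
      next
        case b: False
        then show ?thesis using NorthEast False 2(3-) IH[of "s + 1" "a + 1" "b - 1"] by simp
      qed
    qed
  qed
qed

text \<open>A walk that sinks under these bounds has to begin with SE, after which the bounds are
  positive and \<open>sinks_cut_peaks\<close> applies. An initial bump would break the bound on the
  left side only.\<close>

lemma sinks_cut_peaks_0:
  assumes "grounded s w" "1 \<le> a" "North \<notin> set w"
    and "\<not> (w \<noteq> [] \<and> hd w = NorthEast \<and> descends (tl w))"
  shows "sinks a 1 w \<longleftrightarrow> sinks a 0 (cut_peaks w)"
proof (cases w)
  case Nil
  then show ?thesis by simp
next
  case (Cons x v)
  show ?thesis
  proof (cases x)
    case NorthEast
    then show ?thesis using Cons assms by simp
  next
    case SouthEast
    have "sinks (a - 1) 2 v \<longleftrightarrow> sinks (a - 1) 1 (cut_peaks v)"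
      using sinks_cut_peaks[of "s - 1" v "a - 1" 1] assms SouthEast Cons
      by (cases "a = 1") (auto simp: sinks_nonpos)
    then show ?thesis using Cons SouthEast by simp
  next
    case North
    then show ?thesis using Cons assms by simp
  next
    case East
    then have "s = 0" using Cons assms by simp
    then have "\<not> sinks a 1 w" using sinks_le[OF assms(1)] assms(2) by fastforce
    then show ?thesis using Cons East assms by simp
  qed
qed

abbreviation starts_bump :: "step list \<Rightarrow> bool" where
  "starts_bump v \<equiv> v \<noteq> [] \<and> hd v = NorthEast \<and> descends (tl v)"

text \<open>All peaks deleted from one gap give rise to the same vertex of the shortened path, and only
  the leftmost of them counts; the conditional summand makes up for the gap being shared
  when \<open>v\<close> begins with a deleted peak.\<close>

lemma peak_count_cut_peaks_acc:
  assumes "1 \<le> r" "grounded s v" "grounded s w" "North \<notin> set v" "North \<notin> set w"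
    and "\<not> (descends v \<and> descends w)"
  shows "peak_count (r + 1) v w + (if starts_bump v then of_bool (gap_peak r (cut_peaks v) (cut_peaks w)) else 0)
       = peak_count r (cut_peaks v) (cut_peaks w)"
  using assms
proof (induction w arbitrary: s v rule: cut_peaks.induct)
  case 1
  then show ?case by (simp add: gap_peak_def)
next
  case (2 x w)
  note gv = \<open>grounded s v\<close> and gw = \<open>grounded s (x # w)\<close>
  show ?case
  proof (cases "x = NorthEast \<and> descends w")
    case True
    then obtain u where u: "w = SouthEast # u" by (auto elim: descendsE)
    let ?g = "gap_peak r (cut_peaks v) (cut_peaks u)"
    have su: "sinks r 2 u \<longleftrightarrow> sinks r 1 (cut_peaks u)"
      using sinks_cut_peaks[of s u r 1] 2(3-) True u by simp
    \<comment> \<open>A bump directly to the left reaches the same height as the present one, which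
      a peak forbids on its left; so only the leftmost bump of a gap can count.\<close>
    have sv: "sinks r 1 v \<longleftrightarrow> \<not> starts_bump v \<and> sinks r 0 (cut_peaks v)"
    proof (cases "starts_bump v")
      case True
      then show ?thesis using 2(3) by (cases v) auto
    next
      case False
      then show ?thesis using sinks_cut_peaks_0[OF gv] 2(3-) by auto
    qed
    have "gap_peak (r + 1) (SouthEast # v) (SouthEast # u) \<longleftrightarrow> \<not> starts_bump v \<and> ?g"
      using su sv 2(3) by (auto simp: gap_peak_def)
    moreover have "\<not> gap_peak (r + 1) v (NorthEast # SouthEast # u)"
      using 2(3) by (simp add: gap_peak_def)
    \<comment> \<open>Behind the bump the reversed prefix begins with it, so the conditional summand
      of the induction hypothesis is exactly \<open>?g\<close>.\<close>
    moreover have "peak_count (r + 1) (NorthEast # SouthEast # v) u + of_bool ?g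
        = peak_count r (cut_peaks v) (cut_peaks u)"
      using 2(1)[OF True, of s "NorthEast # SouthEast # v"] 2(3-) True u
        grounded_nonneg[OF gv] by simp
    ultimately show ?thesis using True u by (auto simp: of_bool_def)
  next
    case False
    have nx: "x \<noteq> North" using 2(7) by auto
    have nd: "\<not> (x = SouthEast \<and> descends v)" using 2(8) by auto
    \<comment> \<open>Leaving a peak, both walks begin with SE, which \<open>nd\<close>
      excludes.\<close>
    have gx: "\<not> gap_peak (r + 1) v (x # w)"
    proof
      assume g: "gap_peak (r + 1) v (x # w)"
      then have s: "r + 1 \<le> s" using sinks_le[OF gv] by (auto simp: gap_peak_def)
      then have "x \<noteq> East" using gw 2(3) by auto
      moreover have "x \<noteq> NorthEast" using g 2(3) by (auto simp: gap_peak_def)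
      ultimately have "x = SouthEast" using nx by (cases x) auto
      moreover from g have "descends v"
      proof (cases v)
        case Nil
        then show ?thesis using g 2(3) by (simp add: gap_peak_def)
      next
        case (Cons y v')
        then show ?thesis using g 2(3,6) by (cases y) (auto simp: gap_peak_def)
      qed
      ultimately show False using nd by simp
    qed
    \<comment> \<open>In the shortened word this gap can be a peak only if a bump was deleted
      directly to its left, and then the conditional summand supplies it.\<close>
    have gx': "starts_bump v" if g: "gap_peak r (cut_peaks v) (x # cut_peaks w)"
    proof (rule ccontr)
      assume nb: "\<not> starts_bump v"
      then have sv: "sinks r 1 v" using g sinks_cut_peaks_0[OF gv 2(3) 2(6)] by (simp add: gap_peak_def)
      then have s: "r \<le> s" using sinks_le[OF gv] by blast
      then have "x \<noteq> East" using gw 2(3) by auto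
      moreover have "x \<noteq> NorthEast" using g 2(3) by (auto simp: gap_peak_def)
      ultimately have x: "x = SouthEast" using nx by (cases x) auto
      show False
      proof (cases v)
        case Nil
        then show ?thesis using sv 2(3) by simp
      next
        case (Cons y v')
        then show ?thesis using sv 2(3,6) nd x s gv by (cases y) auto
      qed
    qed
    have c: "cut_peaks (flip x # v) = flip x # cut_peaks v"
      using nd nx by (cases x) auto
    have "grounded (s + rise x) (flip x # v)"
      using gv gw nx grounded_nonneg[of "s + rise x" w] by (cases x) auto
    then have "peak_count (r + 1) (flip x # v) w = peak_count r (flip x # cut_peaks v) (cut_peaks w)"
      using 2(2)[OF False, of "s + rise x" "flip x # v"] 2(3-) gw nd nx False c
      by (cases x) auto
    then show ?thesis using False gx gx' by auto
  qed
qed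

lemma peak_count_cut_peaks:
  assumes "1 \<le> r" "grounded s w" "North \<notin> set w"
  shows "peak_count (r + 1) [] w = peak_count r [] (cut_peaks w)"
  using peak_count_cut_peaks_acc[of r s "[]" w] assms grounded_nonneg[OF assms(2)] by simp

section \<open>Multiplicities of the deleted peaks\<close>

text \<open>A SE step put in front of a word appears, flipped, at the far end of the reversed
  prefix, where climbing reaches no new depth.\<close>

lemma peak_count_snoc_NE [simp]: "peak_count r (v @ [NorthEast]) w = peak_count r v w"
proof (induction w arbitrary: v)
  case (Cons x w)
  then show ?case using Cons.IH[of "flip x # v"] by (simp add: gap_peak_def)
qed (simp add: gap_peak_def)

lemma peak_count_Cons_SE:
  assumes "1 \<le> r"
  shows "peak_count r [] (SouthEast # w) = peak_count r [] w"
  using assms peak_count_snoc_NE[of r "[]" w] by (simp add: gap_peak_def)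

lemma sinks_append_East [simp]: "sinks a b (w @ replicate j East) \<longleftrightarrow> sinks a b w"
proof (induction w arbitrary: a b)
  case Nil
  then show ?case by (induction j arbitrary: a b) auto
qed auto

text \<open>A walk that starts among the final East steps never sinks, so no vertex there
  counts.\<close>

lemma peak_count_append_East:
  assumes "1 \<le> r"
  shows "peak_count r v (w @ replicate j East) = peak_count r v w"
proof (induction w arbitrary: v)
  case Nil
  have *: "\<not> sinks r 1 (replicate i East)" for i
    using assms sinks_append_East[of r 1 "[]" i] by simp
  have "peak_count r v (replicate j East) = 0"
  proof (induction j arbitrary: v)
    case 0
    then show ?case using assms by (simp add: gap_peak_def)
  next
    case (Suc j)
    then show ?case using *[of "Suc j"] by (simp add: gap_peak_def)
  qed
  then show ?case using assms by (simp add: gap_peak_def)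
next
  case (Cons x w)
  then show ?case using sinks_append_East[of r 1 "x # w" j] by (simp add: gap_peak_def)
qed

section \<open>Number of peaks and major index of a word\<close>

fun peak_num :: "step list \<Rightarrow> nat" where
  "peak_num [] = 0"
| "peak_num (y # w) = of_bool (rise y = 1 \<and> descends w) + peak_num w"

fun maj :: "int \<Rightarrow> step list \<Rightarrow> int" where
  "maj x [] = 0"
| "maj x (y # w) = (if rise y = 1 \<and> descends w then x + run y else 0) + maj (x + run y) w"

lemma maj_shift: "maj (x + d) w = maj x w + d * int (peak_num w)"
proof (induction w arbitrary: x)
  case (Cons y w)
  then show ?case using Cons.IH[of "x + run y"] by (simp add: algebra_simps)
qed simp

text \<open>A peak sinks by 1 on either side through its own two steps. The last summand is the peak
  at the current gap, whose ascent belongs to \<open>v\<close> and is missing from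
  \<open>peak_num w\<close>.\<close>

lemma peak_count_1_acc:
  assumes "path_word k s w" "grounded s v"
  shows "peak_count 1 v w = peak_num w + of_bool (descends v \<and> descends w)"
  using assms
proof (induction w arbitrary: s v)
  case Nil
  then show ?case by (simp add: gap_peak_def)
next
  case (Cons x w)
  have "\<not> sinks 1 1 w" if "x = East"
    using Cons.prems that sinks_le[OF path_word_grounded, of k s w 1 1] by auto
  then have "gap_peak 1 v (x # w) \<longleftrightarrow> descends v \<and> x = SouthEast"
    by (cases v; cases "hd v"; cases x) (auto simp: gap_peak_def sinks_nonpos)
  moreover have "grounded (s + rise x) (flip x # v)"
    using Cons.prems path_word_grounded[of k "s + rise x" w] grounded_nonneg[of "s + rise x" w]
    by (cases x) auto
  moreover have "flip x = SouthEast \<longleftrightarrow> rise x = 1" by (cases x) auto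
  moreover have "path_word k (s + rise x) w" using Cons.prems by simp
  ultimately show ?case using Cons.IH[of "s + rise x" "flip x # v"] by simp
qed

lemma peak_count_1: "path_word k s w \<Longrightarrow> peak_count 1 [] w = peak_num w"
  using peak_count_1_acc[of k s w "[]"] grounded_nonneg[OF path_word_grounded] by simp

text \<open>\<open>mult w i\<close> is the number of peaks deleted from gap \<open>i\<close> of \<open>cut_peaks w\<close>.  As a function
  on all of \<open>nat\<close> it does not change when East steps are appended to \<open>w\<close>.\<close>

fun mult :: "step list \<Rightarrow> nat \<Rightarrow> nat" where
  "mult [] = (\<lambda>_. 0)"
| "mult (x # w) = (if x = NorthEast \<and> descends w
     then (mult (tl w))(0 := Suc (mult (tl w) 0)) else case_nat 0 (mult w))"

fun ins :: "step list \<Rightarrow> (nat \<Rightarrow> nat) \<Rightarrow> step list" where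
  "ins [] m = concat (replicate (m 0) [NorthEast, SouthEast])"
| "ins (x # w) m = concat (replicate (m 0) [NorthEast, SouthEast]) @ x # ins w (m \<circ> Suc)"

text \<open>Indicator of the gaps that are peaks, numbered as for \<open>mult\<close>. Gap 1 of
  \<open>x # w\<close> is gap 0 of \<open>w\<close>; its entry depends on \<open>x\<close>, hence
  the update.\<close>

fun peak_gap :: "step list \<Rightarrow> nat \<Rightarrow> nat" where
  "peak_gap [] = (\<lambda>_. 0)"
| "peak_gap (x # w) = case_nat 0 ((peak_gap w)(0 := of_bool (x = NorthEast \<and> descends w)))"

lemma peak_gap_0 [simp]: "peak_gap w 0 = 0"
  by (cases w) auto

lemma case_nat_fun_upd_comp_Suc [simp]: "case_nat a f \<circ> Suc = f" "f(0 := a) \<circ> Suc = f \<circ> Suc"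
  by auto

lemma ins_Suc: "ins w (m(0 := Suc (m 0))) = NorthEast # SouthEast # ins w m"
  by (cases w) auto

lemma ins_cut_peaks: "ins (cut_peaks P) (mult P) = P"
proof (induction P rule: cut_peaks.induct)
  case (2 x w)
  show ?case
  proof (cases "x = NorthEast \<and> descends w")
    case True
    then obtain u where u: "w = SouthEast # u" by (auto elim: descendsE)
    have m: "mult (x # w) = (mult u)(0 := Suc (mult u 0))" using True u by simp
    have c: "cut_peaks (x # w) = cut_peaks u" using True u by simp
    show ?thesis unfolding m c ins_Suc using 2(1)[OF True] True u by simp
  next
    case False
    show ?thesis unfolding mult.simps(2) cut_peaks.simps(2) if_not_P[OF False] using 2(2)[OF False] by simp
  qed
qed simp

text \<open>Adjacent NE and SE of the shortened word were not adjacent in \<open>P\<close>, or they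
  would have been deleted; only deleted bumps can have separated them.\<close>

lemma peak_gap_le_mult: "peak_gap (cut_peaks P) i \<le> mult P i"
proof (induction P arbitrary: i rule: cut_peaks.induct)
  case (2 x w)
  show ?case
  proof (cases "x = NorthEast \<and> descends w")
    case True
    then show ?thesis using 2(1)[OF True, of i] by (simp add: le_SucI)
  next
    case False
    have "1 \<le> mult w 0" if "descends (cut_peaks w)" "\<not> descends w"
      using that by (cases w) (auto split: if_splits)
    then show ?thesis using False 2(2)[OF False] by (auto split: nat.split simp: Suc_le_eq)
  qed
qed simp

lemma mult_eq_0: "length (cut_peaks P) < i \<Longrightarrow> mult P i = 0"
  by (induction P arbitrary: i rule: cut_peaks.induct) (auto split: nat.split)

lemma peak_gap_eq_0: "length w \<le> i \<Longrightarrow> peak_gap w i = 0"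
  by (induction w arbitrary: i) (auto split: nat.split)

lemma cut_peaks_bumps [simp]: "cut_peaks (concat (replicate n [NorthEast, SouthEast]) @ w) = cut_peaks w"
  by (induction n) auto

lemma mult_bumps: "mult (concat (replicate n [NorthEast, SouthEast]) @ w) = (mult w)(0 := n + mult w 0)"
  by (induction n) auto

lemma descends_ins [simp]: "descends (ins w m) \<longleftrightarrow> m 0 = 0 \<and> descends w"
  by (cases w; cases "m 0") auto

text \<open>By the hypothesis every factor NE SE of \<open>w\<close> is split by an inserted bump,
  so only inserted bumps get deleted.\<close>

lemma cut_peaks_ins: "(\<And>i. peak_gap w i \<le> m i) \<Longrightarrow> cut_peaks (ins w m) = w"
proof (induction w arbitrary: m)
  case Nil
  then show ?case using cut_peaks_bumps[of "m 0" "[]"] by simp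
next
  case (Cons x w)
  have "peak_gap w i \<le> (m \<circ> Suc) i" for i
    using Cons.prems[of "Suc i"] by (cases i) auto
  moreover have "\<not> (x = NorthEast \<and> descends (ins w (m \<circ> Suc)))"
    using Cons.prems[of 1] by auto
  ultimately show ?case using Cons.IH by auto
qed

text \<open>Beyond \<open>length w\<close> there are no gaps, and \<open>ins\<close> would drop
  whatever \<open>m\<close> demands there.\<close>

lemma mult_ins:
  assumes "\<And>i. peak_gap w i \<le> m i" "\<And>i. length w < i \<Longrightarrow> m i = 0"
  shows "mult (ins w m) = m"
  using assms
proof (induction w arbitrary: m)
  case Nil
  then show ?case using mult_bumps[of "m 0" "[]"] by auto
next
  case (Cons x w)
  have "peak_gap w i \<le> (m \<circ> Suc) i" for i
    using Cons.prems(1)[of "Suc i"] by (cases i) auto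
  moreover have nb: "\<not> (x = NorthEast \<and> descends (ins w (m \<circ> Suc)))"
    using Cons.prems(1)[of 1] by auto
  moreover have "(m \<circ> Suc) i = 0" if "length w < i" for i
    using Cons.prems(2) that by simp
  ultimately have e: "mult (ins w (m \<circ> Suc)) = m \<circ> Suc"
    by (intro Cons.IH)
  have "mult (x # ins w (m \<circ> Suc)) = case_nat 0 (m \<circ> Suc)"
    unfolding mult.simps(2) if_not_P[OF nb] e by (rule refl)
  then show ?case by (auto simp: mult_bumps split: nat.split)
qed

section \<open>Trailing East steps\<close>

lemma descends_append_East [simp]: "descends (w @ replicate j East) \<longleftrightarrow> descends w"
  by (cases j) auto

lemma cut_peaks_append_East: "cut_peaks (w @ replicate j East) = cut_peaks w @ replicate j East"
proof (induction w rule: cut_peaks.induct)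
  case 1
  then show ?case by (induction j) auto
qed (auto elim!: descendsE simp del: descends_append)

lemma mult_append_East: "mult (w @ replicate j East) = mult w"
proof (induction w rule: cut_peaks.induct)
  case 1
  then show ?case by (induction j) (auto split: nat.split)
qed (auto elim!: descendsE simp del: descends_append)

lemma peak_gap_append_East: "peak_gap (w @ replicate j East) = peak_gap w"
proof (induction w)
  case Nil
  then show ?case by (induction j) (auto split: nat.split)
qed (auto simp del: descends_append)

text \<open>Forgetting the number of exposed East steps puts the shortened words into the same class
  as the original ones; \<open>bij_encode\<close> shows that nothing is lost.\<close>

definition strip :: "step list \<Rightarrow> step list" where
  "strip w = rev (dropWhile (\<lambda>x. x = East) (rev w))"

lemma strip_append_East [simp]: "strip (w @ replicate j East) = strip w"
  by (simp add: strip_def dropWhile_append)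

lemma strip_decomp: "\<exists>j. w = strip w @ replicate j East"
proof (induction w rule: rev_induct)
  case Nil
  then show ?case by (simp add: strip_def)
next
  case (snoc x w)
  then show ?case
  proof (cases "x = East")
    case True
    from snoc obtain j where "w = strip w @ replicate j East" by blast
    then have "w @ [x] = strip (w @ [x]) @ replicate (Suc j) East"
      using True strip_append_East[of w 1] by (simp add: replicate_append_same[symmetric])
    then show ?thesis by blast
  next
    case False
    then show ?thesis by (intro exI[of _ 0]) (simp add: strip_def)
  qed
qed

lemma strip_id: "w = [] \<or> last w \<noteq> East \<Longrightarrow> strip w = w"
  by (cases w rule: rev_cases) (auto simp: strip_def)

lemma strip_last: "strip w = [] \<or> last (strip w) \<noteq> East"
  unfolding strip_def using hd_dropWhile[of "\<lambda>x. x = East" "rev w"]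
  by (auto simp: last_rev)

lemma path_word_append_East: "path_word k s (w @ replicate j East) \<longleftrightarrow> path_word k s w"
proof (induction w arbitrary: s)
  case Nil
  then show ?case by (induction j) auto
qed (auto simp del: descends_append)

text \<open>Apart from the start, only tops of bumps can lie at height \<open>k - 1\<close>, because
  an undeleted ascent is followed by another one. The start is covered by
  \<open>s < k - 1\<close>.\<close>

lemma path_word_cut_peaks:
  assumes "path_word k s w" "North \<notin> set w" "s < k - 1"
  shows "path_word (k - 1) s (cut_peaks w)"
  using assms
proof (induction w arbitrary: s rule: cut_peaks.induct)
  case 1
  then show ?case by simp
next
  case (2 x w)
  show ?case
  proof (cases "x = NorthEast \<and> descends w")
    case True
    then show ?thesis using 2(1)[OF True, of s] 2(3-) by (auto elim!: descendsE)
  next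
    case False
    have "s + 2 < k" if "x = NorthEast"
    proof (cases w)
      case Nil
      then show ?thesis using that 2(3) by simp
    next
      case (Cons y v)
      then have "y = NorthEast" using that False 2(3,4) by (cases y) auto
      then show ?thesis using that Cons 2(3) by (cases v) auto
    qed
    then have "s + rise x < k - 1" using 2(4,5) by (cases x) auto
    then show ?thesis using False 2(2)[OF False, of "s + rise x"] 2(3-) by auto
  qed
qed

lemma set_cut_peaks: "set (cut_peaks w) \<subseteq> set w"
  by (induction w rule: cut_peaks.induct) (auto elim!: descendsE)

lemma path_word_bumps:
  assumes "path_word k s w" "0 \<le> s" "s + 1 < k"
  shows "path_word k s (concat (replicate n [NorthEast, SouthEast]) @ w)"
  using assms by (induction n) auto

lemma path_word_ins:
  assumes "path_word (k - 1) s w" "North \<notin> set w"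
  shows "path_word k s (ins w m)"
  using assms
proof (induction w arbitrary: s m)
  case Nil
  then show ?case using path_word_bumps[of k s "[]" "m 0"] by simp
next
  case (Cons x w)
  then show ?case by (auto intro!: path_word_bumps)
qed

lemma set_ins: "set (ins w m) \<subseteq> set w \<union> {NorthEast, SouthEast}"
proof (induction w arbitrary: m)
  case (Cons x w)
  then show ?case using Cons[of "m \<circ> Suc"] by auto
qed auto

section \<open>Peak numbers and major index in terms of multiplicities\<close>

lemma peak_num_mult:
  assumes "length (cut_peaks w) \<le> n" "North \<notin> set w"
  shows "peak_num w = (\<Sum>i\<le>n. mult w i)"
  using assms
proof (induction w arbitrary: n rule: cut_peaks.induct)
  case (2 x w)
  show ?case
  proof (cases "x = NorthEast \<and> descends w")
    case True
    then have "peak_num (tl w) = (\<Sum>i\<le>n. mult (tl w) i)"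
      using 2(1)[OF True, of n] 2(3-) by (auto elim!: descendsE)
    moreover have "peak_num (x # w) = Suc (peak_num (tl w))"
      using True by (auto elim!: descendsE)
    ultimately show ?thesis using True by (cases n) (auto simp: sum.atMost_Suc_shift simp del: sum.atMost_Suc)
  next
    case False
    then obtain n' where n: "n = Suc n'" using 2(3) by (cases n) auto
    have "rise x = 1 \<longleftrightarrow> x = NorthEast" using 2(4) by (cases x) auto
    then show ?thesis using False 2(2)[OF False, of n'] 2(3-) n
      by (auto simp: sum.atMost_Suc_shift simp del: sum.atMost_Suc)
  qed
qed simp

text \<open>The \<open>j\<close>-th deleted peak, if taken from gap \<open>g\<close>, had weight \<open>x + g + 2 * j - 1\<close>.\<close>

lemma maj_mult:
  assumes "length (cut_peaks w) \<le> n" "North \<notin> set w"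
  shows "maj x w = (\<Sum>i\<le>n. (x + int i) * int (mult w i)) + (int (peak_num w))\<^sup>2"
  using assms
proof (induction w arbitrary: n x rule: cut_peaks.induct)
  case (2 y w)
  show ?case
  proof (cases "y = NorthEast \<and> descends w")
    case True
    then obtain u where u: "w = SouthEast # u" by (auto elim: descendsE)
    let ?S = "\<lambda>x. \<Sum>i\<le>n. (x + int i) * int (mult u i)"
    have p: "peak_num u = (\<Sum>i\<le>n. mult u i)"
      using peak_num_mult[of u n] 2(3-) True u by simp
    \<comment> \<open>With \<open>p = peak_num u\<close>, the deleted bump shifts \<open>p\<close>
      later peaks by 2 and has its own top at \<open>x + 1\<close>; this turns \<open>p^2\<close>
      into \<open>(p + 1)^2\<close>.\<close>
    have "maj (x + 2) u = ?S x + 2 * int (peak_num u) + (int (peak_num u))\<^sup>2"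
      using 2(1)[OF True, of n "x + 2"] 2(3-) True u
      by (simp add: p algebra_simps sum.distrib sum_distrib_left)
    moreover have "(\<Sum>i\<le>n. (x + int i) * int (mult (y # w) i)) = x + ?S x"
      using True u by (cases n) (auto simp: sum.atMost_Suc_shift algebra_simps simp del: sum.atMost_Suc)
    ultimately show ?thesis using True u by (simp add: power2_eq_square algebra_simps)
  next
    case False
    then obtain n' where n: "n = Suc n'" using 2(3) by (cases n) auto
    have "rise y = 1 \<longleftrightarrow> y = NorthEast" "run y = 1" using 2(4) by (cases y; simp)+
    then show ?thesis using False 2(2)[OF False, of n' "x + 1"] 2(3-) n
      by (auto simp: sum.atMost_Suc_shift algebra_simps simp del: sum.atMost_Suc)
  qed
qed simp

lemma peak_num_peak_gap:
  assumes "length w \<le> n" "North \<notin> set w"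
  shows "peak_num w = (\<Sum>i\<le>n. peak_gap w i)"
  using assms
proof (induction w arbitrary: n)
  case (Cons x w)
  then obtain n' where n: "n = Suc n'" by (cases n) auto
  have x: "rise x = 1 \<longleftrightarrow> x = NorthEast" using Cons.prems by (cases x) auto
  have "peak_num w = (\<Sum>i\<le>n'. peak_gap w i)" using Cons n by simp
  then show ?case using n x
    by (cases n') (auto simp: sum.atMost_Suc_shift simp del: sum.atMost_Suc)
qed simp

text \<open>Without North steps every step has run 1, so gap \<open>i\<close> has abscissa
  \<open>x + i\<close>.\<close>

lemma maj_peak_gap:
  assumes "length w \<le> n" "North \<notin> set w"
  shows "maj x w = (\<Sum>i\<le>n. (x + int i) * int (peak_gap w i))"
  using assms
proof (induction w arbitrary: n x)
  case (Cons y w)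
  then obtain n' where n: "n = Suc n'" by (cases n) auto
  have y: "rise y = 1 \<longleftrightarrow> y = NorthEast" "run y = 1" using Cons.prems by (cases y; simp)+
  have "maj (x + 1) w = (\<Sum>i\<le>n'. (x + 1 + int i) * int (peak_gap w i))" using Cons n by simp
  then show ?case using n y
    by (cases n') (auto simp: sum.atMost_Suc_shift algebra_simps simp del: sum.atMost_Suc)
qed simp

section \<open>Paths without North steps\<close>

definition plain_words :: "int \<Rightarrow> int \<Rightarrow> step list set" where
  "plain_words k s = {w. path_word k s w \<and> North \<notin> set w \<and> (w = [] \<or> last w \<noteq> East)}"

definition finite_support :: "(nat \<Rightarrow> nat) set" where
  "finite_support = {e. \<exists>n. \<forall>i\<ge>n. e i = 0}"

text \<open>At least one peak must have been deleted from each gap that is a peak of the shortened path.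
  The multiplicities in excess of this are arbitrary, hence independent of the shortened path.\<close>

definition encode :: "step list \<Rightarrow> step list \<times> (nat \<Rightarrow> nat)" where
  "encode w = (strip (cut_peaks w), \<lambda>i. mult w i - peak_gap (cut_peaks w) i)"

lemma strip_invariant:
  assumes "\<And>v j. F (v @ replicate j East) = F v"
  shows "F (strip w) = F w"
  using assms strip_decomp[of w] by metis

lemmas path_word_strip = strip_invariant[of "path_word k s" for k s, OF path_word_append_East]
lemmas mult_strip = strip_invariant[of mult, OF mult_append_East]
lemmas peak_gap_strip = strip_invariant[of peak_gap, OF peak_gap_append_East]

lemma peak_count_strip: "1 \<le> r \<Longrightarrow> peak_count r v (strip w) = peak_count r v w"
  using strip_invariant[of "peak_count r v"] peak_count_append_East by metis

lemma set_strip: "set (strip w) \<subseteq> set w"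
  unfolding strip_def by (auto dest: set_dropWhileD)

lemma strip_plain: "\<lbrakk>path_word k s w; North \<notin> set w\<rbrakk> \<Longrightarrow> strip w \<in> plain_words k s"
  using set_strip[of w] strip_last[of w] by (auto simp: plain_words_def path_word_strip)

text \<open>For the inverse, add one bump per peak of the shortened word to the excess
  multiplicities, pad with East steps, insert and strip.\<close>

lemma bij_encode:
  assumes "s < k - 1"
  shows "bij_betw encode (plain_words k s) (plain_words (k - 1) s \<times> finite_support)"
  unfolding bij_betw_def
proof
  show "inj_on encode (plain_words k s)"
  proof (rule inj_onI)
    fix P Q
    assume P: "P \<in> plain_words k s" and Q: "Q \<in> plain_words k s" and e: "encode P = encode Q"
    from e have c: "strip (cut_peaks P) = strip (cut_peaks Q)"
      and m: "\<And>i. mult P i - peak_gap (cut_peaks P) i = mult Q i - peak_gap (cut_peaks Q) i"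
      by (auto simp: encode_def dest: fun_cong)
    have "peak_gap (cut_peaks P) = peak_gap (cut_peaks Q)"
      using c peak_gap_strip by metis
    then have "mult P i = mult Q i" for i
      using m[of i] peak_gap_le_mult[of P i] peak_gap_le_mult[of Q i] by simp
    then have m: "mult P = mult Q" by blast
    \<comment> \<open>The shortened words may still differ in their final East steps. Padding each
      by the number of the other makes them equal, and \<open>ins\<close> recovers equal padded
      originals.\<close>
    obtain a b where "cut_peaks P = strip (cut_peaks P) @ replicate a East"
      and "cut_peaks Q = strip (cut_peaks P) @ replicate b East"
      using strip_decomp c by metis
    then have "cut_peaks (P @ replicate b East) = cut_peaks (Q @ replicate a East)"
      unfolding cut_peaks_append_East
      by (metis add.commute append.assoc replicate_add)
    then have "P @ replicate b East = Q @ replicate a East"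
      using m ins_cut_peaks mult_append_East by metis
    then have "strip P = strip Q" by (metis strip_append_East)
    then show "P = Q" using P Q strip_id by (auto simp: plain_words_def)
  qed
  show "encode ` plain_words k s = plain_words (k - 1) s \<times> finite_support"
  proof (intro equalityI subsetI)
    fix y assume "y \<in> encode ` plain_words k s"
    then obtain P where P: "P \<in> plain_words k s" "y = encode P" by blast
    have "strip (cut_peaks P) \<in> plain_words (k - 1) s"
      using P path_word_cut_peaks[OF _ _ assms] set_cut_peaks[of P]
      by (intro strip_plain) (auto simp: plain_words_def)
    moreover have "(\<lambda>i. mult P i - peak_gap (cut_peaks P) i) \<in> finite_support"
      unfolding finite_support_def using mult_eq_0[of P]
      by (auto intro!: exI[of _ "Suc (length (cut_peaks P))"])
    ultimately show "y \<in> plain_words (k - 1) s \<times> finite_support"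
      using P by (simp add: encode_def)
  next
    fix y assume y: "y \<in> plain_words (k - 1) s \<times> finite_support"
    then obtain w e where w: "y = (w, e)" "w \<in> plain_words (k - 1) s" "e \<in> finite_support"
      by blast
    then obtain n where n: "\<And>i. n \<le> i \<Longrightarrow> e i = 0" by (auto simp: finite_support_def)
    define m where "m i = e i + peak_gap w i" for i
    \<comment> \<open>As \<open>e\<close> vanishes from \<open>n\<close> on, \<open>n\<close>
      further East steps provide a gap for every bump to be inserted.\<close>
    let ?v = "w @ replicate n East"
    let ?Q = "ins ?v m"
    have gm: "peak_gap ?v i \<le> m i" for i by (simp add: m_def peak_gap_append_East)
    have m0: "length ?v < i \<Longrightarrow> m i = 0" for i
      using n[of i] peak_gap_eq_0[of w i] by (simp add: m_def)
    have c: "cut_peaks ?Q = ?v" using cut_peaks_ins[OF gm] .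
    obtain j where "?Q = strip ?Q @ replicate j East" using strip_decomp by blast
    then have c': "cut_peaks (strip ?Q) @ replicate j East = ?v"
      using c cut_peaks_append_East by metis
    then have "strip (cut_peaks (strip ?Q)) = w"
      using w strip_append_East[of "cut_peaks (strip ?Q)" j] strip_append_East[of w n] strip_id[of w]
      by (simp add: plain_words_def)
    moreover have "mult (strip ?Q) = m" using mult_ins[OF gm m0] by (simp add: mult_strip)
    moreover have "peak_gap (cut_peaks (strip ?Q)) = peak_gap w"
      using c' peak_gap_append_East by metis
    ultimately have "encode (strip ?Q) = y" by (auto simp: encode_def m_def w)
    moreover have "strip ?Q \<in> plain_words k s"
    proof (rule strip_plain)
      show "path_word k s ?Q"
        using w by (intro path_word_ins) (auto simp: plain_words_def path_word_append_East)
      show "North \<notin> set ?Q"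
        using w set_ins[of ?v m] by (auto simp: plain_words_def)
    qed
    ultimately show "y \<in> encode ` plain_words k s" by blast
  qed
qed

lemma peak_num_strip: "peak_num (strip w) = peak_num w"
proof (rule strip_invariant)
  show "peak_num (v @ replicate j East) = peak_num v" for v j
  proof (induction v)
    case Nil
    then show ?case by (induction j) auto
  qed (simp del: descends_append)
qed

lemma maj_strip: "maj x (strip w) = maj x w"
proof (rule strip_invariant)
  show "maj x (v @ replicate j East) = maj x v" for v j
  proof (induction v arbitrary: x)
    case Nil
    then show ?case by (induction j arbitrary: x) auto
  qed (simp del: descends_append)
qed

text \<open>All large upper limits are allowed, so that the sums for two words with the same excess
  \<open>e\<close> can be taken over one range.\<close>

lemma peak_num_encode:
  assumes "encode w = (v, e)" "North \<notin> set w"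
  shows "\<exists>n0. \<forall>n\<ge>n0. peak_num w = peak_num v + (\<Sum>i\<le>n. e i)"
proof (intro exI[of _ "length (cut_peaks w)"] allI impI)
  fix n assume n: "length (cut_peaks w) \<le> n"
  have c: "North \<notin> set (cut_peaks w)" using assms set_cut_peaks by blast
  have "peak_num v = (\<Sum>i\<le>n. peak_gap (cut_peaks w) i)"
    using assms peak_num_peak_gap[OF n c] by (auto simp: encode_def peak_num_strip)
  moreover have "mult w i = peak_gap (cut_peaks w) i + e i" for i
    using assms peak_gap_le_mult[of w i] by (auto simp: encode_def)
  ultimately show "peak_num w = peak_num v + (\<Sum>i\<le>n. e i)"
    using peak_num_mult[OF n assms(2)] by (simp add: sum.distrib)
qed

text \<open>Besides \<open>maj 0 v\<close>, only \<open>e\<close> and the number of peaks enter.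
  Words sharing both differ in major index exactly as their shortened words do.\<close>

lemma maj_encode:
  assumes "encode w = (v, e)" "North \<notin> set w"
  shows "\<exists>n0. \<forall>n\<ge>n0. maj 0 w = maj 0 v + (\<Sum>i\<le>n. int i * int (e i)) + (int (peak_num w))\<^sup>2"
proof (intro exI[of _ "length (cut_peaks w)"] allI impI)
  fix n assume n: "length (cut_peaks w) \<le> n"
  have c: "North \<notin> set (cut_peaks w)" using assms set_cut_peaks by blast
  have "maj 0 v = (\<Sum>i\<le>n. int i * int (peak_gap (cut_peaks w) i))"
    using assms maj_peak_gap[OF n c] by (auto simp: encode_def maj_strip)
  moreover have "mult w i = peak_gap (cut_peaks w) i + e i" for i
    using assms peak_gap_le_mult[of w i] by (auto simp: encode_def)
  ultimately show "maj 0 w = maj 0 v + (\<Sum>i\<le>n. int i * int (e i)) + (int (peak_num w))\<^sup>2"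
    using maj_mult[OF n assms(2), of 0] by (simp add: sum.distrib algebra_simps)
qed

lemma peak_count_encode:
  assumes "encode w = (v, e)" "w \<in> plain_words k s" "1 \<le> r"
  shows "peak_count (r + 1) [] w = peak_count r [] v"
  using assms peak_count_cut_peaks[of r s w]
  by (auto simp: encode_def plain_words_def peak_count_strip path_word_grounded)

text \<open>At height \<open>k - 1\<close> the bound forbids an ascent, and East requires height 0,
  so the first step is SE.\<close>

lemma bij_Cons_SE:
  assumes "2 \<le> k"
  shows "bij_betw ((#) SouthEast) (plain_words k (k - 2)) (plain_words k (k - 1))"
proof (rule bij_betw_imageI)
  show "(#) SouthEast ` plain_words k (k - 2) = plain_words k (k - 1)"
  proof (intro equalityI subsetI)
    fix w assume "w \<in> (#) SouthEast ` plain_words k (k - 2)"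
    then show "w \<in> plain_words k (k - 1)" using assms by (auto simp: plain_words_def split: if_splits)
  next
    fix w assume w: "w \<in> plain_words k (k - 1)"
    then obtain x v where x: "w = x # v"
      using assms by (cases w) (auto simp: plain_words_def)
    have k: "path_word k (k - 1 + rise x) v" using w x by (simp add: plain_words_def)
    have "k - 1 + rise x < k" using k by (cases v) auto
    then have "x = SouthEast" using w x assms by (cases x) (auto simp: plain_words_def)
    then show "w \<in> (#) SouthEast ` plain_words k (k - 2)"
      using w x assms by (auto simp: plain_words_def split: if_splits)
  qed
qed simp

text \<open>Preservation of the peak counts belongs to the induction because its case
  \<open>r = 1\<close> makes the squares in \<open>maj_encode\<close> agree.\<close>

lemma plain_bijection:
  "\<exists>f. bij_betw f (plain_words (int (Suc k)) 0) (plain_words (int (Suc k)) (int k)) \<and>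
     (\<forall>w \<in> plain_words (int (Suc k)) 0.
        (\<forall>r\<ge>1. peak_count (int r) [] (f w) = peak_count (int r) [] w) \<and>
        maj 0 (f w) = maj 0 w + (\<Sum>r = 1..k. int (peak_count (int r) [] w)))"
proof (induction k)
  case 0
  show ?case by (intro exI[of _ "\<lambda>w. w"]) (auto simp: bij_betw_def)
next
  case (Suc k)
  define K where "K = int (Suc (Suc k))"
  have K: "K - 1 = int (Suc k)" "K - 2 = int k" "2 \<le> K" by (auto simp: K_def)
  from Suc obtain f where f: "bij_betw f (plain_words (K - 1) 0) (plain_words (K - 1) (K - 2))"
    and fc: "\<And>w r. \<lbrakk>w \<in> plain_words (K - 1) 0; 1 \<le> r\<rbrakk> \<Longrightarrow>
        peak_count (int r) [] (f w) = peak_count (int r) [] w"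
    and fm: "\<And>w. w \<in> plain_words (K - 1) 0 \<Longrightarrow>
        maj 0 (f w) = maj 0 w + (\<Sum>r = 1..k. int (peak_count (int r) [] w))"
    unfolding K by metis
  define d where "d = the_inv_into (plain_words K (K - 2)) encode"
  \<comment> \<open>The shortened word is replaced by its image under \<open>f\<close>, while the
    excess multiplicities are kept.\<close>
  define g where "g = d \<circ> map_prod f id \<circ> encode"
  have e0: "bij_betw encode (plain_words K 0) (plain_words (K - 1) 0 \<times> finite_support)"
    using K by (intro bij_encode) simp
  have e1: "bij_betw encode (plain_words K (K - 2)) (plain_words (K - 1) (K - 2) \<times> finite_support)"
    by (intro bij_encode) simp
  have d: "bij_betw d (plain_words (K - 1) (K - 2) \<times> finite_support) (plain_words K (K - 2))"
    unfolding d_def by (rule bij_betw_the_inv_into[OF e1])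
  have mp: "bij_betw (map_prod f id) (plain_words (K - 1) 0 \<times> finite_support)
      (plain_words (K - 1) (K - 2) \<times> finite_support)"
    by (intro bij_betw_map_prod f) auto
  have g: "bij_betw g (plain_words K 0) (plain_words K (K - 2))"
    unfolding g_def by (intro bij_betw_trans[OF bij_betw_trans[OF e0 mp] d, simplified comp_assoc[symmetric]])
  have "bij_betw ((#) SouthEast \<circ> g) (plain_words K 0) (plain_words K (K - 1))"
    by (rule bij_betw_trans[OF g bij_Cons_SE]) (use K in simp)
  moreover have "(\<forall>r\<ge>1. peak_count (int r) [] (((#) SouthEast \<circ> g) w) = peak_count (int r) [] w) \<and>
      maj 0 (((#) SouthEast \<circ> g) w) = maj 0 w + (\<Sum>r = 1..Suc k. int (peak_count (int r) [] w))"
    if w: "w \<in> plain_words K 0" for w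
  proof -
    obtain v e where v: "encode w = (v, e)" by force
    have vp: "v \<in> plain_words (K - 1) 0"
      using bij_betwE[OF e0] w v by fastforce
    have gw: "g w \<in> plain_words K (K - 2)" using bij_betwE[OF g] w by blast
    have "encode (g w) = map_prod f id (encode w)"
      unfolding g_def d_def comp_apply
      using bij_betwE[OF mp] bij_betwE[OF e0] w e1
      by (intro f_the_inv_into_f_bij_betw[OF e1]) blast
    then have gv: "encode (g w) = (f v, e)" using v by simp
    have N: "North \<notin> set w" "North \<notin> set (g w)" using w gw by (auto simp: plain_words_def)
    have fv: "f v \<in> plain_words (K - 1) (K - 2)" using bij_betwE[OF f] vp by blast
    have p1: "peak_num u = peak_count 1 [] u" if "u \<in> plain_words k s" for u k s
      using that peak_count_1[of k s u] by (simp add: plain_words_def)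
    have nv: "peak_num (f v) = peak_num v"
      using fc[OF vp, of 1] p1[OF vp] p1[OF fv] by simp
    obtain n1 n2 where
      "\<And>n. n1 \<le> n \<Longrightarrow> peak_num w = peak_num v + (\<Sum>i\<le>n. e i)"
      "\<And>n. n2 \<le> n \<Longrightarrow> peak_num (g w) = peak_num (f v) + (\<Sum>i\<le>n. e i)"
      using peak_num_encode[OF v N(1)] peak_num_encode[OF gv N(2)] by blast
    from this(1)[of "max n1 n2"] this(2)[of "max n1 n2"] have n: "peak_num (g w) = peak_num w"
      using nv by simp
    obtain n1 n2 where
      "\<And>n. n1 \<le> n \<Longrightarrow> maj 0 w = maj 0 v + (\<Sum>i\<le>n. int i * int (e i)) + (int (peak_num w))\<^sup>2"
      "\<And>n. n2 \<le> n \<Longrightarrow> maj 0 (g w) = maj 0 (f v) + (\<Sum>i\<le>n. int i * int (e i)) + (int (peak_num (g w)))\<^sup>2"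
      using maj_encode[OF v N(1)] maj_encode[OF gv N(2)] by blast
    from this(1)[of "max n1 n2"] this(2)[of "max n1 n2"]
    have "maj 0 (g w) - maj 0 w = maj 0 (f v) - maj 0 v" using n by simp
    then have m: "maj 0 (g w) = maj 0 w + (\<Sum>r = 1..k. int (peak_count (int r) [] v))"
      using fm[OF vp] by simp
    have c: "peak_count (int (Suc r)) [] w = peak_count (int r) [] v" if "1 \<le> r" for r
      using peak_count_encode[OF v w, of "int r"] that by (simp add: add.commute)
    have c': "peak_count (int (Suc r)) [] (g w) = peak_count (int r) [] (f v)" if "1 \<le> r" for r
      using peak_count_encode[OF gv gw, of "int r"] that by (simp add: add.commute)
    have gc: "peak_count (int r) [] (g w) = peak_count (int r) [] w" if r: "1 \<le> r" for r
    proof (cases "r = 1")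
      case True
      then show ?thesis using n p1[OF w] p1[OF gw] by simp
    next
      case False
      then obtain r' where "r = Suc r'" "1 \<le> r'" using r by (cases r) auto
      then show ?thesis using c[of r'] c'[of r'] fc[OF vp, of r'] by simp
    qed
    have shift: "(\<Sum>r = 1..Suc k. F r) = F 1 + (\<Sum>r = 1..k. F (Suc r))" for F :: "nat \<Rightarrow> int"
      by (induction k) auto
    \<comment> \<open>The new first step shifts every peak by 1, which supplies the summand
      \<open>r = 1\<close>; the other summands are those of \<open>v\<close> with index raised by
      one.\<close>
    have "maj 0 (SouthEast # g w) = maj 0 (g w) + int (peak_num w)"
      using maj_shift[of 0 1 "g w"] n by simp
    also have "\<dots> = maj 0 w + int (peak_count (int 1) [] w) + (\<Sum>r = 1..k. int (peak_count (int (Suc r)) [] w))"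
      using m p1[OF w] c by simp
    also have "\<dots> = maj 0 w + (\<Sum>r = 1..Suc k. int (peak_count (int r) [] w))"
      using shift[of "\<lambda>r. int (peak_count (int r) [] w)"] by simp
    finally have "maj 0 (SouthEast # g w) = maj 0 w + (\<Sum>r = 1..Suc k. int (peak_count (int r) [] w))" .
    moreover have "peak_count (int r) [] (SouthEast # g w) = peak_count (int r) [] w" if "1 \<le> r" for r
      using gc[OF that] peak_count_Cons_SE[of "int r" "g w"] that by linarith
    ultimately show ?thesis unfolding comp_apply by blast
  qed
  ultimately show ?case unfolding K_def[symmetric] K(1)[symmetric] by blast
qed

section \<open>North steps\<close>

definition path_words :: "int \<Rightarrow> int \<Rightarrow> step list set" where
  "path_words k s = {w. path_word k s w \<and> (w = [] \<or> last w \<noteq> East)}"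

fun types :: "step list \<Rightarrow> bool list" where
  "types [] = []"
| "types (y # w) = (if rise y = 1 \<and> descends w then [y = North] else []) @ types w"

fun tilt :: "step \<Rightarrow> step" where
  "tilt North = NorthEast"
| "tilt x = x"

text \<open>Restores a word from its tilted form and its list of peak types, each peak consuming one
  entry.\<close>

fun mark :: "bool list \<Rightarrow> step list \<Rightarrow> step list" where
  "mark ts [] = []"
| "mark ts (y # w) = (if y = NorthEast \<and> descends w
     then (if hd ts then North else NorthEast) # mark (tl ts) w else y # mark ts w)"

text \<open>Making a peak an NSE peak moves this peak and all later ones one unit to the left.\<close>

fun mark_cost :: "bool list \<Rightarrow> int" where
  "mark_cost [] = 0"
| "mark_cost (t # ts) = (if t then 1 + int (length ts) else 0) + mark_cost ts"

lemma rise_tilt [simp]: "rise (tilt x) = rise x"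
  and flip_tilt [simp]: "flip (tilt x) = flip x"
  and tilt_eq [simp]: "tilt x = SouthEast \<longleftrightarrow> x = SouthEast" "tilt x = East \<longleftrightarrow> x = East"
    "tilt x \<noteq> North" "tilt x = NorthEast \<longleftrightarrow> rise x = 1"
  by (cases x; simp)+

lemma length_types: "length (types w) = peak_num w"
  by (induction w) auto

lemma descends_map_tilt [simp]: "descends (map tilt w) \<longleftrightarrow> descends w"
  by (cases w) auto

lemma sinks_map_tilt [simp]: "sinks a b (map tilt w) \<longleftrightarrow> sinks a b w"
  by (induction w arbitrary: a b) auto

lemma peak_count_map_tilt [simp]: "peak_count r v (map tilt w) = peak_count r v w"
  by (induction w arbitrary: v) (auto simp: gap_peak_def)

lemma peak_num_map_tilt [simp]: "peak_num (map tilt w) = peak_num w"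
  by (induction w) auto

lemma map_tilt_plain: "w \<in> path_words k s \<Longrightarrow> map tilt w \<in> plain_words k s"
proof -
  have "path_word k s w \<Longrightarrow> path_word k s (map tilt w)"
    by (induction w arbitrary: s) auto
  then show "w \<in> path_words k s \<Longrightarrow> map tilt w \<in> plain_words k s"
    by (auto simp: path_words_def plain_words_def last_map tilt_eq(3)[symmetric])
qed

lemma descends_mark [simp]: "descends (mark ts w) \<longleftrightarrow> descends w"
  by (cases w) auto

lemma mark_eq_Nil [simp]: "mark ts w = [] \<longleftrightarrow> w = []"
  by (cases w) auto

lemma last_mark: "w \<noteq> [] \<Longrightarrow> last (mark ts w) = East \<longleftrightarrow> last w = East"
proof (induction w arbitrary: ts)
  case (Cons y w)
  then show ?case by (cases "w = []") auto
qed simp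

lemma path_word_mark: "path_word k s w \<Longrightarrow> path_word k s (mark ts w)"
  by (induction w arbitrary: s ts) auto

lemma map_tilt_mark: "North \<notin> set w \<Longrightarrow> map tilt (mark ts w) = w"
proof (induction w arbitrary: ts)
  case (Cons y w)
  then show ?case by (cases y) auto
qed simp

lemma types_mark: "\<lbrakk>North \<notin> set w; length ts = peak_num w\<rbrakk> \<Longrightarrow> types (mark ts w) = ts"
proof (induction w arbitrary: ts)
  case (Cons y w)
  then show ?case by (cases y; cases ts) (auto split: if_splits)
qed simp

text \<open>In a path word North occurs only directly before SE, so tilting loses nothing but the
  types of the peaks.\<close>

lemma mark_types: "path_word k s w \<Longrightarrow> mark (types w) (map tilt w) = w"
proof (induction w arbitrary: s)
  case (Cons y w)
  then show ?case by (cases y) auto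
qed simp

lemma mark_path_words: "w \<in> plain_words k s \<Longrightarrow> mark ts w \<in> path_words k s"
  by (cases "w = []") (auto simp: path_words_def plain_words_def path_word_mark last_mark)

lemma maj_mark:
  "\<lbrakk>North \<notin> set w; length ts = peak_num w\<rbrakk> \<Longrightarrow> maj x (mark ts w) = maj x w - mark_cost ts"
proof (induction w arbitrary: x ts)
  case (Cons y w)
  show ?case
  proof (cases "y = NorthEast \<and> descends w")
    case True
    then obtain t ts' where ts: "ts = t # ts'" "length ts' = peak_num w"
      using Cons.prems by (cases ts) auto
    then show ?thesis
      using True Cons.IH[of ts' x] Cons.IH[of ts' "x + 1"] Cons.prems maj_shift[of x 1 w] by auto
  next
    case False
    then have "\<not> (rise y = 1 \<and> descends w)" using Cons.prems by (cases y) auto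
    then show ?thesis using False Cons by auto
  qed
qed simp

text \<open>\<open>mark_cost\<close> depends only on the types, which are kept, so restoring North
  steps lowers the major index of a word and of its image by the same amount.\<close>

lemma path_bijection:
  "\<exists>f. bij_betw f (path_words (int (Suc k)) 0) (path_words (int (Suc k)) (int k)) \<and>
     (\<forall>w \<in> path_words (int (Suc k)) 0. types (f w) = types w \<and>
        (\<forall>r\<ge>1. peak_count (int r) [] (f w) = peak_count (int r) [] w) \<and>
        maj 0 (f w) = maj 0 w + (\<Sum>r = 1..k. int (peak_count (int r) [] w)))"
proof -
  let ?K = "int (Suc k)"
  obtain f where f: "bij_betw f (plain_words ?K 0) (plain_words ?K (int k))"
    and fc: "\<And>w r. \<lbrakk>w \<in> plain_words ?K 0; 1 \<le> r\<rbrakk> \<Longrightarrow>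
        peak_count (int r) [] (f w) = peak_count (int r) [] w"
    and fm: "\<And>w. w \<in> plain_words ?K 0 \<Longrightarrow>
        maj 0 (f w) = maj 0 w + (\<Sum>r = 1..k. int (peak_count (int r) [] w))"
    using plain_bijection[of k] by metis
  have plain: "North \<notin> set w" "path_word ?K s w" if "w \<in> plain_words ?K s" for w s
    using that by (auto simp: plain_words_def)
  have fp: "f w \<in> plain_words ?K (int k)" if "w \<in> plain_words ?K 0" for w
    using bij_betwE[OF f] that by blast
  have fn: "peak_num (f w) = peak_num w" if "w \<in> plain_words ?K 0" for w
    using fc[OF that, of 1] peak_count_1[OF plain(2)[OF that]] peak_count_1[OF plain(2)[OF fp[OF that]]]
    by simp
  define g where "g w = mark (types w) (f (map tilt w))" for w
  have g: "types (g w) = types w" "map tilt (g w) = f (map tilt w)"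
    "maj 0 (g w) = maj 0 (f (map tilt w)) - mark_cost (types w)"
    "g w \<in> path_words ?K (int k)"
    if "w \<in> path_words ?K 0" for w
    using map_tilt_plain[OF that] plain(1)[OF fp[OF map_tilt_plain[OF that]]]
      mark_path_words[OF fp[OF map_tilt_plain[OF that]]] fn[OF map_tilt_plain[OF that]]
    by (simp_all add: g_def types_mark map_tilt_mark maj_mark length_types)
  have m: "mark (types w) (map tilt w) = w" if "w \<in> path_words ?K s" for w s
    using that mark_types by (auto simp: path_words_def)
  have "bij_betw g (path_words ?K 0) (path_words ?K (int k))"
  proof (rule bij_betw_imageI)
    show "inj_on g (path_words ?K 0)"
    proof (rule inj_onI)
      fix v w assume v: "v \<in> path_words ?K 0" and w: "w \<in> path_words ?K 0" and e: "g v = g w"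
      have "types v = types w" "f (map tilt v) = f (map tilt w)"
        using g(1,2)[OF v] g(1,2)[OF w] e by simp_all
      then show "v = w"
        using bij_betw_imp_inj_on[OF f] map_tilt_plain[OF v] map_tilt_plain[OF w] m[OF v] m[OF w]
        by (metis inj_onD)
    qed
    show "g ` path_words ?K 0 = path_words ?K (int k)"
    proof (intro equalityI subsetI)
      fix y assume y: "y \<in> path_words ?K (int k)"
      then obtain u where u: "u \<in> plain_words ?K 0" "f u = map tilt y"
        using map_tilt_plain bij_betw_imp_surj_on[OF f] by (metis imageE)
      have n: "length (types y) = peak_num u" using fn[OF u(1)] u(2) by (simp add: length_types)
      let ?w = "mark (types y) u"
      have "g ?w = y"
        using plain(1)[OF u(1)] n m[OF y] u(2) by (simp add: g_def types_mark map_tilt_mark)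
      then show "y \<in> g ` path_words ?K 0" using mark_path_words[OF u(1), of "types y"] by (intro rev_image_eqI[of ?w]) simp_all
    qed (use g(4) in auto)
  qed
  moreover have "types (g w) = types w \<and>
      (\<forall>r\<ge>1. peak_count (int r) [] (g w) = peak_count (int r) [] w) \<and>
      maj 0 (g w) = maj 0 w + (\<Sum>r = 1..k. int (peak_count (int r) [] w))"
    if w: "w \<in> path_words ?K 0" for w
  proof (intro conjI allI impI)
    note p = map_tilt_plain[OF w]
    show "types (g w) = types w" using g(1)[OF w] .
    show "peak_count (int r) [] (g w) = peak_count (int r) [] w" if "1 \<le> r" for r
      using fc[OF p that] g(2)[OF w] peak_count_map_tilt by metis
    have "maj 0 w = maj 0 (map tilt w) - mark_cost (types w)"
      using maj_mark[OF plain(1)[OF p], of "types w" 0] m[OF w] by (simp add: length_types)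
    then show "maj 0 (g w) = maj 0 w + (\<Sum>r = 1..k. int (peak_count (int r) [] w))"
      using g(3)[OF w] fm[OF p] by simp
  qed
  ultimately show ?thesis by blast
qed

section \<open>Exchanging the type of the first peak\<close>

fun toggle :: "step list \<Rightarrow> step list" where
  "toggle [] = []"
| "toggle (y # w) = (if rise y = 1 \<and> descends w
     then (if y = North then NorthEast else North) # w else y # toggle w)"

lemma descends_toggle [simp]: "descends (toggle w) \<longleftrightarrow> descends w"
  by (cases w) auto

lemma toggle_toggle [simp]: "toggle (toggle w) = w"
proof (induction w)
  case (Cons y w)
  then show ?case by (cases y) auto
qed simp

lemma toggle_eq_Nil [simp]: "toggle w = [] \<longleftrightarrow> w = []"
  by (cases w) auto

lemma last_toggle: "w \<noteq> [] \<Longrightarrow> last (toggle w) = last w"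
proof (induction w)
  case (Cons y w)
  then show ?case by (cases w) auto
qed simp

lemma path_word_toggle [simp]: "path_word k s (toggle w) \<longleftrightarrow> path_word k s w"
proof (induction w arbitrary: s)
  case (Cons y w)
  then show ?case by (cases y) auto
qed simp

lemma types_toggle: "types (toggle w) = (case types w of [] \<Rightarrow> [] | t # ts \<Rightarrow> (\<not> t) # ts)"
proof (induction w)
  case (Cons y w)
  then show ?case by (cases y) auto
qed simp

lemma sinks_toggle [simp]: "sinks a b (toggle w) \<longleftrightarrow> sinks a b w"
proof (induction w arbitrary: a b)
  case (Cons y w)
  then show ?case by (cases y) auto
qed simp

lemma peak_count_toggle [simp]: "peak_count r v (toggle w) = peak_count r v w"
proof (induction w arbitrary: v)
  case (Cons y w)
  have "gap_peak r v (toggle (y # w)) \<longleftrightarrow> gap_peak r v (y # w)"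
    by (simp only: gap_peak_def sinks_toggle)
  then show ?case using Cons by (cases y) (auto split: if_splits)
qed simp

text \<open>Replacing NE by North saves one unit of run before the first peak and so moves all peaks
  one to the left; starting at \<open>x + 1\<close> makes up for it.\<close>

lemma maj_toggle: "\<lbrakk>types w \<noteq> []; \<not> hd (types w)\<rbrakk> \<Longrightarrow> maj (x + 1) (toggle w) = maj x w"
proof (induction w arbitrary: x)
  case (Cons y w)
  then show ?case using Cons.IH[of "x + run y"]
    by (cases y) (auto split: if_splits simp: algebra_simps)
qed simp

text \<open>The larger start height makes up for the new descent. On the target side
  \<open>descends w\<close> is the starting condition for paths of positive start height whose
  leftmost peak is an NSE peak.\<close>

lemma bij_toggle:
  assumes "0 \<le> s" "s + 1 < k"
  shows "bij_betw (\<lambda>w. SouthEast # toggle w)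
     {w \<in> path_words k s. types w \<noteq> [] \<and> \<not> hd (types w)}
     {w \<in> path_words k (s + 1). descends w \<and> types w \<noteq> [] \<and> hd (types w)}"
    (is "bij_betw ?f ?A ?B")
proof (rule bij_betw_byWitness[where f' = "\<lambda>w. toggle (tl w)"])
  show "?f ` ?A \<subseteq> ?B"
    using assms by (auto simp: path_words_def types_toggle last_toggle split: list.splits if_splits)
  show "(\<lambda>w. toggle (tl w)) ` ?B \<subseteq> ?A"
    by (auto elim!: descendsE simp: path_words_def types_toggle last_toggle split: list.splits if_splits)
  show "\<forall>w\<in>?B. ?f (toggle (tl w)) = w" by (auto elim!: descendsE)
qed simp

section \<open>Words and paths\<close>

lemma fold_move: "fold move w (a, b) = (a + sum_list (map run w), b + sum_list (map rise w))"
proof (induction w arbitrary: a b)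
  case (Cons x w)
  then show ?case by (cases x) auto
qed simp

lemma weight_eq: "weight (h, w) i = sum_list (map run (take i w))"
  and height_eq: "height (h, w) i = h + sum_list (map rise (take i w))"
  by (simp_all add: weight_def height_def vertex_def fold_move)

lemma weight_0 [simp]: "weight (h, w) 0 = 0"
  and height_0 [simp]: "height (h, w) 0 = h"
  and weight_Cons_Suc: "weight (h, x # w) (Suc i) = run x + weight (h', w) i"
  and height_Cons_Suc: "height (h, x # w) (Suc i) = height (h + rise x, w) i"
  by (simp_all add: weight_eq height_eq)

lemma weight_Suc: "i < length w \<Longrightarrow> weight (h, w) (Suc i) = weight (h, w) i + run (w ! i)"
  and height_Suc: "i < length w \<Longrightarrow> height (h, w) (Suc i) = height (h, w) i + rise (w ! i)"
  by (simp_all add: weight_eq height_eq take_Suc_conv_app_nth)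

lemma descends_iff: "descends w \<longleftrightarrow> 0 < length w \<and> w ! 0 = SouthEast"
  by (cases w) auto

lemma path_word_iff:
  "path_word k h w \<longleftrightarrow>
     (\<forall>i < Suc (length w). 0 \<le> height (h, w) i \<and> height (h, w) i < k) \<and>
     height (h, w) (length w) = 0 \<and>
     (\<forall>i < length w. w ! i = East \<longrightarrow> height (h, w) i = 0) \<and>
     (\<forall>i < length w. w ! i = North \<longrightarrow> Suc i < length w \<and> w ! Suc i = SouthEast)"
proof (induction w arbitrary: h)
  case Nil
  then show ?case by auto
next
  case (Cons x w)
  have "(\<forall>i < Suc (Suc (length w)). 0 \<le> height (h, x # w) i \<and> height (h, x # w) i < k) \<longleftrightarrow>
      0 \<le> h \<and> h < k \<and> (\<forall>i < Suc (length w). 0 \<le> height (h + rise x, w) i \<and> height (h + rise x, w) i < k)"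
    by (subst All_less_Suc2) (simp add: height_Cons_Suc)
  moreover have "(\<forall>i < Suc (length w). (x # w) ! i = East \<longrightarrow> height (h, x # w) i = 0) \<longleftrightarrow>
      (x = East \<longrightarrow> h = 0) \<and> (\<forall>i < length w. w ! i = East \<longrightarrow> height (h + rise x, w) i = 0)"
    by (subst All_less_Suc2) (simp add: height_Cons_Suc)
  moreover have "(\<forall>i < Suc (length w). (x # w) ! i = North \<longrightarrow>
        Suc i < Suc (length w) \<and> (x # w) ! Suc i = SouthEast) \<longleftrightarrow>
      (x = North \<longrightarrow> descends w) \<and>
      (\<forall>i < length w. w ! i = North \<longrightarrow> Suc i < length w \<and> w ! Suc i = SouthEast)"
    by (subst All_less_Suc2) (simp add: descends_iff)
  ultimately show ?case unfolding path_word.simps Cons.IH length_Cons height_Cons_Suc by blast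
qed

lemma path_word_last: "\<lbrakk>path_word k s w; w \<noteq> []\<rbrakk> \<Longrightarrow> last w \<noteq> East \<longleftrightarrow> last w = SouthEast"
proof (induction w arbitrary: s)
  case (Cons x w)
  show ?case
  proof (cases "w = []")
    case True
    then show ?thesis using Cons.prems by (cases x) auto
  next
    case False
    then show ?thesis using Cons by auto
  qed
qed simp

section \<open>Peaks and major index of a path\<close>

lemma peaks_iff:
  "i \<in> peaks (h, w) \<longleftrightarrow> 0 < i \<and> i < length w \<and> rise (w ! (i - 1)) = 1 \<and> w ! i = SouthEast"
proof -
  have "rise x = 1 \<longleftrightarrow> x = NorthEast \<or> x = North" for x by (cases x) auto
  then show ?thesis by (auto simp: peaks_def NESE_peaks_def NSE_peaks_def)
qed

lemma NSE_peaks_iff: "i \<in> NSE_peaks (h, w) \<longleftrightarrow> i \<in> peaks (h, w) \<and> w ! (i - 1) = North"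
  and NESE_peaks_iff: "i \<in> NESE_peaks (h, w) \<longleftrightarrow> i \<in> peaks (h, w) \<and> w ! (i - 1) \<noteq> North"
  by (auto simp: peaks_def NESE_peaks_def NSE_peaks_def)

lemma peaks_Nil: "peaks (h, []) = {}"
  by (auto simp: peaks_iff)

lemma peaks_Cons:
  "peaks (h, x # w) = Suc ` peaks (h', w) \<union> (if rise x = 1 \<and> descends w then {1} else {})"
proof (rule set_eqI)
  fix i
  show "i \<in> peaks (h, x # w) \<longleftrightarrow>
      i \<in> Suc ` peaks (h', w) \<union> (if rise x = 1 \<and> descends w then {1} else {})"
  proof (cases i)
    case 0
    then show ?thesis by (auto simp: peaks_iff)
  next
    case (Suc j)
    then show ?thesis by (cases j) (auto simp: peaks_iff descends_iff image_iff)
  qed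
qed

lemma finite_peaks: "finite (peaks (h, w))"
  by (rule finite_subset[of _ "{..<length w}"]) (auto simp: peaks_iff)

lemma sum_weight_peaks: "(\<Sum>i \<in> peaks (h, w). x + weight (h, w) i) = maj x w"
proof (induction w arbitrary: x h)
  case Nil
  then show ?case by (simp add: peaks_Nil)
next
  case (Cons y w)
  have "1 \<notin> Suc ` peaks (h, w)" by (auto simp: peaks_iff)
  moreover have "(\<Sum>i \<in> Suc ` peaks (h, w). x + weight (h, y # w) i) = maj (x + run y) w"
    by (subst sum.reindex) (simp_all add: weight_Cons_Suc[of _ _ _ _ h] add.assoc[symmetric] Cons)
  ultimately show ?case
    using finite_peaks[of h w] weight_Cons_Suc[of h y w 0 h]
    by (auto simp: peaks_Cons[of h y w h])
qed

lemma major_index_eq: "major_index (h, w) = maj 0 w"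
  using sum_weight_peaks[of 0 h w] by (simp add: major_index_def)

lemma weight_mono: "i \<le> j \<Longrightarrow> weight (h, w) i \<le> weight (h, w) j"
proof (rule lift_Suc_mono_le)
  fix n
  show "weight (h, w) n \<le> weight (h, w) (Suc n)"
  proof (cases "n < length w")
    case True
    then show ?thesis by (cases "w ! n") (auto simp: weight_Suc)
  qed (simp add: weight_eq)
qed

text \<open>North steps have run 0, so weights are only weakly monotone in the index; they become
  strict behind a peak, which is followed by SE.\<close>

lemma weight_less:
  assumes "i < j" "i < length w" "w ! i = SouthEast"
  shows "weight (h, w) i < weight (h, w) j"
  using weight_mono[of "Suc i" j h w] assms by (simp add: weight_Suc)

lemma is_leftmost_peak_iff:
  "is_leftmost_peak (h, w) i \<longleftrightarrow> i \<in> peaks (h, w) \<and> (\<forall>j \<in> peaks (h, w). i \<le> j)"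
proof -
  have "weight (h, w) i \<le> weight (h, w) j \<longleftrightarrow> i \<le> j" if "j \<in> peaks (h, w)" for j
  proof (cases "i \<le> j")
    case True
    then show ?thesis using weight_mono[of i j h w] by simp
  next
    case False
    then show ?thesis using that weight_less[of j i w h] by (simp add: peaks_iff)
  qed
  then show ?thesis by (auto simp: is_leftmost_peak_def)
qed

lemma leftmost_peak_types:
  "(\<exists>i. is_leftmost_peak (h, w) i \<and> (w ! (i - 1) = North) = t) \<longleftrightarrow>
     types w \<noteq> [] \<and> hd (types w) = t"
proof (induction w arbitrary: h)
  case Nil
  then show ?case by (simp add: is_leftmost_peak_iff peaks_Nil)
next
  case (Cons y w)
  show ?case
  proof (cases "rise y = 1 \<and> descends w")
    case True
    have "is_leftmost_peak (h, y # w) i \<longleftrightarrow> i = 1" for i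
      unfolding is_leftmost_peak_iff peaks_Cons[of h y w h] using True
      by (auto simp: peaks_iff)
    then show ?thesis using True by simp
  next
    case False
    have "is_leftmost_peak (h, y # w) i \<longleftrightarrow> (\<exists>j. i = Suc j \<and> is_leftmost_peak (h, w) j)" for i
      unfolding is_leftmost_peak_iff peaks_Cons[of h y w h] using False by auto
    moreover have nz: "j \<noteq> 0" if "is_leftmost_peak (h, w) j" for j
      using that by (auto simp: is_leftmost_peak_iff peaks_iff)
    moreover have "(y # w) ! (Suc j - 1) = w ! (j - 1)" if "is_leftmost_peak (h, w) j" for j
      using nz[OF that] by (simp add: nth_Cons')
    ultimately have "(\<exists>i. is_leftmost_peak (h, y # w) i \<and> ((y # w) ! (i - 1) = North) = t) \<longleftrightarrow>
      (\<exists>j. is_leftmost_peak (h, w) j \<and> (w ! (j - 1) = North) = t)"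
      by metis
    then show ?thesis unfolding types.simps if_not_P[OF False] append_Nil Cons .
  qed
qed

lemma leftmost_NSE_iff:
  "(\<exists>i. is_leftmost_peak (h, w) i \<and> i \<in> NSE_peaks (h, w)) \<longleftrightarrow> types w \<noteq> [] \<and> hd (types w)"
  using leftmost_peak_types[of h w True] by (auto simp: NSE_peaks_iff is_leftmost_peak_def)

lemma leftmost_NESE_iff:
  "(\<exists>i. is_leftmost_peak (h, w) i \<and> i \<in> NESE_peaks (h, w)) \<longleftrightarrow> types w \<noteq> [] \<and> \<not> hd (types w)"
  using leftmost_peak_types[of h w False] by (auto simp: NESE_peaks_iff is_leftmost_peak_def)

section \<open>Relative heights\<close>

lemma peak_count_eq_card:
  "peak_count r v w = card {i. i \<le> length w \<and> gap_peak r (rev (map flip (take i w)) @ v) (drop i w)}"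
proof (induction w arbitrary: v)
  case Nil
  then show ?case by (auto simp: card_eq_0_iff)
next
  case (Cons x w)
  let ?A = "{i. i \<le> length w \<and> gap_peak r (rev (map flip (take i w)) @ flip x # v) (drop i w)}"
  have fin: "finite ?A" by simp
  have "{i. i \<le> length (x # w) \<and> gap_peak r (rev (map flip (take i (x # w))) @ v) (drop i (x # w))}
    = Suc ` ?A \<union> (if gap_peak r v (x # w) then {0} else {})" (is "?L = ?R")
  proof (rule set_eqI)
    fix i show "i \<in> ?L \<longleftrightarrow> i \<in> ?R"
      by (cases i) auto
  qed
  moreover have "card ?R = card ?A + of_bool (gap_peak r v (x # w))"
    using fin by (auto simp: card_image card_insert_if)
  ultimately show ?case using Cons by simp
qed

text \<open>\<open>g\<close> is any function with the slopes of \<open>xs\<close> as increments, so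
  that heights read in either direction can be inserted.\<close>

lemma sinks_iff:
  assumes "\<And>j. j < length xs \<Longrightarrow> g (Suc j) = g j + rise (xs ! j)"
  shows "sinks a b xs \<longleftrightarrow>
     (\<exists>j \<le> length xs. g j \<le> g 0 - a \<and> (\<forall>i. 0 < i \<and> i \<le> j \<longrightarrow> g i < g 0 + b))"
  using assms
proof (induction xs arbitrary: g a b)
  case Nil
  then show ?case by auto
next
  case (Cons x xs)
  have g1: "g (Suc 0) = g 0 + rise x" using Cons.prems[of 0] by simp
  have IH: "sinks (a + rise x) (b - rise x) xs \<longleftrightarrow>
     (\<exists>j \<le> length xs. g (Suc j) \<le> g 0 - a \<and> (\<forall>i. 0 < i \<and> i \<le> j \<longrightarrow> g (Suc i) < g 0 + b))"
    using Cons.IH[of "g \<circ> Suc" "a + rise x" "b - rise x"] Cons.prems[of "Suc _"] g1 by simp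
  have split: "(\<forall>i. 0 < i \<and> i \<le> Suc j \<longrightarrow> P i) \<longleftrightarrow> P 1 \<and> (\<forall>i. 0 < i \<and> i \<le> j \<longrightarrow> P (Suc i))" for j P
    by (metis One_nat_def Suc_le_mono gr0_conv_Suc le0 not_gr_zero zero_less_Suc)
  have ex: "(\<exists>j \<le> length (x # xs). P j) \<longleftrightarrow> P 0 \<or> (\<exists>j \<le> length xs. P (Suc j))" for P
    by (metis Suc_le_mono le0 length_Cons not0_implies_Suc)
  show ?case unfolding ex split sinks.simps IH using g1 by auto
qed

lemma gap_peak_iff:
  assumes i: "i \<le> length w"
  shows "gap_peak r (rev (map flip (take i w))) (drop i w) \<longleftrightarrow>
     (\<exists>u \<le> i. height (h, w) u \<le> height (h, w) i - r \<and>
        (\<forall>j. u \<le> j \<and> j < i \<longrightarrow> height (h, w) j < height (h, w) i)) \<and>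
     (\<exists>v \<le> length w. i \<le> v \<and> height (h, w) v \<le> height (h, w) i - r \<and>
        (\<forall>j. i < j \<and> j \<le> v \<longrightarrow> height (h, w) j \<le> height (h, w) i))"
    (is "_ \<longleftrightarrow> ?L \<and> ?R")
proof -
  let ?H = "height (h, w)"
  have "?H (i - Suc j) = ?H (i - j) + rise (rev (map flip (take i w)) ! j)" if "j < i" for j
    using that i height_Suc[of "i - Suc j" w h] by (simp add: rev_nth Suc_diff_Suc)
  then have "sinks r 0 (rev (map flip (take i w))) \<longleftrightarrow>
      (\<exists>j \<le> i. ?H (i - j) \<le> ?H i - r \<and> (\<forall>l. 0 < l \<and> l \<le> j \<longrightarrow> ?H (i - l) < ?H i))"
    using sinks_iff[of "rev (map flip (take i w))" "\<lambda>j. ?H (i - j)" r 0] i by (simp add: min_absorb2)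
  also have "\<dots> \<longleftrightarrow> ?L"
  proof safe
    fix j assume "j \<le> i" "?H (i - j) \<le> ?H i - r" and *: "\<forall>l. 0 < l \<and> l \<le> j \<longrightarrow> ?H (i - l) < ?H i"
    moreover have "?H l < ?H i" if "i - j \<le> l" "l < i" for l
      using *[rule_format, of "i - l"] that by simp
    ultimately show ?L by (intro exI[of _ "i - j"]) simp
  next
    fix u assume "u \<le> i" "?H u \<le> ?H i - r" "\<forall>j. u \<le> j \<and> j < i \<longrightarrow> ?H j < ?H i"
    then show "\<exists>j \<le> i. ?H (i - j) \<le> ?H i - r \<and> (\<forall>l. 0 < l \<and> l \<le> j \<longrightarrow> ?H (i - l) < ?H i)"
      by (intro exI[of _ "i - u"]) auto
  qed
  finally have L: "sinks r 0 (rev (map flip (take i w))) \<longleftrightarrow> ?L" .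
  have "sinks r 1 (drop i w) \<longleftrightarrow>
      (\<exists>j \<le> length w - i. ?H (i + j) \<le> ?H i - r \<and> (\<forall>l. 0 < l \<and> l \<le> j \<longrightarrow> ?H (i + l) < ?H i + 1))"
    using sinks_iff[of "drop i w" "\<lambda>j. ?H (i + j)" r 1] i by (simp add: height_Suc)
  also have "\<dots> \<longleftrightarrow> ?R"
  proof safe
    fix j assume "j \<le> length w - i" "?H (i + j) \<le> ?H i - r"
      and *: "\<forall>l. 0 < l \<and> l \<le> j \<longrightarrow> ?H (i + l) < ?H i + 1"
    moreover have "?H l \<le> ?H i" if "i < l" "l \<le> i + j" for l
      using *[rule_format, of "l - i"] that by simp
    ultimately show ?R using i by (intro exI[of _ "i + j"]) simp
  next
    fix v assume "v \<le> length w" "i \<le> v" "?H v \<le> ?H i - r" "\<forall>j. i < j \<and> j \<le> v \<longrightarrow> ?H j \<le> ?H i"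
    then show "\<exists>j \<le> length w - i. ?H (i + j) \<le> ?H i - r \<and> (\<forall>l. 0 < l \<and> l \<le> j \<longrightarrow> ?H (i + l) < ?H i + 1)"
      by (intro exI[of _ "v - i"]) auto
  qed
  finally show ?thesis using L by (simp add: gap_peak_def)
qed

text \<open>The definition of relative height restricts only peaks and compares abscissas, whereas
  \<open>G\<close> restricts all vertices and compares indices. Both agree because the leftmost
  highest vertex of a section with lower ends is itself a peak.\<close>

lemma relative_height_iff:
  assumes pw: "path_word k h w" and r: "1 \<le> r"
  shows "i \<in> peaks (h, w) \<and> r \<le> relative_height (h, w) i \<longleftrightarrow>
     i \<le> length w \<and> gap_peak r (rev (map flip (take i w))) (drop i w)"
proof -
  let ?H = "height (h, w)" and ?X = "weight (h, w)" and ?L = "length w"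
  define G where "G r i \<longleftrightarrow>
     (\<exists>u \<le> i. ?H u \<le> ?H i - r \<and> (\<forall>j. u \<le> j \<and> j < i \<longrightarrow> ?H j < ?H i)) \<and>
     (\<exists>v \<le> ?L. i \<le> v \<and> ?H v \<le> ?H i - r \<and> (\<forall>j. i < j \<and> j \<le> v \<longrightarrow> ?H j \<le> ?H i))" for r i
  have GI: "G r i"
    if "u \<le> i" "?H u \<le> ?H i - r" "\<And>j. \<lbrakk>u \<le> j; j < i\<rbrakk> \<Longrightarrow> ?H j < ?H i"
      "v \<le> ?L" "i \<le> v" "?H v \<le> ?H i - r" "\<And>j. \<lbrakk>i < j; j \<le> v\<rbrakk> \<Longrightarrow> ?H j \<le> ?H i" for u i r v
    unfolding G_def using that by blast
  define S where "S i = {d. \<exists>x' x''. (x', ?H i - d) \<in> vertices (h, w) \<and> (x'', ?H i - d) \<in> vertices (h, w) \<and>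
               x' \<le> ?X i \<and> ?X i < x'' \<and>
               (\<forall>j \<in> peaks (h, w). x' \<le> ?X j \<and> ?X j \<le> x'' \<longrightarrow>
                  ?H j \<le> ?H i \<and> (?H j = ?H i \<longrightarrow> ?X i \<le> ?X j))}" for i
  have rh: "relative_height (h, w) i = Max (S i)" for i by (simp add: relative_height_def S_def)
  have nonneg: "0 \<le> ?H j" if "j \<le> ?L" for j
    using pw that by (simp add: path_word_iff)
  have East: "?H j = 0" if "j < ?L" "w ! j = East" for j
    using pw that by (simp add: path_word_iff)
  have North: "Suc j < ?L \<and> w ! Suc j = SouthEast" if "j < ?L" "w ! j = North" for j
    using pw that by (simp add: path_word_iff)
  have step: "\<bar>?H (Suc j) - ?H j\<bar> \<le> 1" if "j < ?L" for j
    using height_Suc[OF that, of h] by (cases "w ! j") auto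
  have vertex: "(x, y) \<in> vertices (h, w) \<longleftrightarrow> (\<exists>j \<le> ?L. ?X j = x \<and> ?H j = y)" for x y
  proof -
    have "vertices (h, w) = (\<lambda>j. (?X j, ?H j)) ` {..?L}"
      by (simp add: vertices_def weight_def height_def)
    then show ?thesis by auto
  qed
  have finS: "finite (S i)" for i
  proof (rule finite_subset)
    show "S i \<subseteq> (\<lambda>v. ?H i - snd v) ` vertices (h, w)" by (force simp: S_def)
  qed (simp add: vertices_def)
  have GS: "i \<in> peaks (h, w) \<and> r \<in> S i" if G: "G r i" and r: "1 \<le> r" and i: "i \<le> ?L" for r i
  proof -
    from G obtain u0 where u0: "u0 \<le> i" "?H u0 \<le> ?H i - r" and u0': "\<And>j. \<lbrakk>u0 \<le> j; j < i\<rbrakk> \<Longrightarrow> ?H j < ?H i"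
      by (auto simp: G_def)
    from G obtain v0 where v0: "v0 \<le> ?L" "i \<le> v0" "?H v0 \<le> ?H i - r"
      and v0': "\<And>j. \<lbrakk>i < j; j \<le> v0\<rbrakk> \<Longrightarrow> ?H j \<le> ?H i"
      by (auto simp: G_def)
    \<comment> \<open>Heights change by at most 1 per step, so the level exactly \<open>r\<close>
      below is met, as \<open>S\<close> demands.\<close>
    have "\<exists>u. u0 \<le> u \<and> u \<le> i \<and> ?H u = ?H i - r"
      using u0 r i step by (intro nat_intermed_int_val) auto
    then obtain u where u: "u0 \<le> u" "u \<le> i" "?H u = ?H i - r" by blast
    have "\<exists>v. i \<le> v \<and> v \<le> v0 \<and> - ?H v = - (?H i - r)"
      using v0 r i step by (intro nat_intermed_int_val) (auto simp: abs_minus_commute)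
    then obtain v where v: "i \<le> v" "v \<le> v0" "?H v = ?H i - r" by auto
    have ui: "u < i" and iv: "i < v" using u v r by (auto simp: order.strict_iff_order)
    have "?H (i - 1) < ?H i" using u0' ui u(1) by simp
    then have up: "rise (w ! (i - 1)) = 1"
      using height_Suc[of "i - 1" w h] ui i by (cases "w ! (i - 1)") auto
    have "?H (Suc i) \<le> ?H i" using v0' iv v(2) by simp
    then have "w ! i = SouthEast \<or> w ! i = East"
      using height_Suc[of i w h] iv v v0 by (cases "w ! i") auto
    moreover have "w ! i \<noteq> East" using East[of i] iv v v0 r nonneg[of v] by fastforce
    ultimately have se: "w ! i = SouthEast" by blast
    then have pk: "i \<in> peaks (h, w)" using up ui iv v v0 by (simp add: peaks_iff)
    have "?H j \<le> ?H i \<and> (?H j = ?H i \<longrightarrow> ?X i \<le> ?X j)"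
      if j: "j \<in> peaks (h, w)" "?X u \<le> ?X j" "?X j \<le> ?X v" for j
    proof -
      have jS: "j < ?L" "w ! j = SouthEast" using j by (auto simp: peaks_iff)
      have "u \<le> j" using weight_less[of j u w h] jS j by fastforce
      show ?thesis
      proof (cases "j \<le> v")
        case True
        show ?thesis
        proof (cases "j < i")
          case True
          then show ?thesis using u0'[of j] u \<open>u \<le> j\<close> by simp
        next
          case False
          then show ?thesis using v0'[of j] \<open>j \<le> v\<close> v weight_mono[of i j h w] by (cases "i = j") auto
        qed
      next
        case False
        \<comment> \<open>A peak behind \<open>v\<close> with the same abscissa can only be the top
          of a North step leaving \<open>v\<close>; it has height \<open>?H i - r + 1\<close>, which
          does not exceed \<open>?H i\<close>.\<close>
        then have vL: "v < j" by simp
        then have "?X (Suc v) \<le> ?X j" using weight_mono[of "Suc v" j h w] by simp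
        then have "run (w ! v) = 0" using weight_Suc[of v w h] weight_mono[of v "Suc v" h w] j(3) jS vL by simp
        then have N: "w ! v = North" by (cases "w ! v") auto
        then have "w ! Suc v = SouthEast" "Suc v < ?L" using North[of v] vL jS by auto
        then have "\<not> Suc v < j" using weight_less[of "Suc v" j w h] weight_mono[of v "Suc v" h w] j(3) by fastforce
        then have "j = Suc v" using vL by simp
        then have "?H j = ?H v + 1" using height_Suc[of v w h] vL jS N by simp
        then show ?thesis using v r weight_mono[of i j h w] vL iv by auto
      qed
    qed
    moreover have "?X u \<le> ?X i" using weight_mono u by simp
    moreover have "?X i < ?X v" using weight_less[of i v w h] iv v v0 se by simp
    moreover have "(?X u, ?H i - r) \<in> vertices (h, w)"
      unfolding vertex using u i by (intro exI[of _ u]) simp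
    moreover have "(?X v, ?H i - r) \<in> vertices (h, w)"
      unfolding vertex using v v0 by (intro exI[of _ v]) simp
    ultimately show ?thesis using pk unfolding S_def by blast
  qed
  have SG: "G r i" if i: "i \<in> peaks (h, w)" and r: "1 \<le> r" "r \<in> S i" for r i
  proof -
    have iL: "0 < i" "i < ?L" "w ! i = SouthEast" using i by (auto simp: peaks_iff)
    from r(2) obtain u v where uv: "u \<le> ?L" "v \<le> ?L" "?H u = ?H i - r" "?H v = ?H i - r"
      "?X u \<le> ?X i" "?X i < ?X v"
      and pk: "\<And>j. \<lbrakk>j \<in> peaks (h, w); ?X u \<le> ?X j; ?X j \<le> ?X v\<rbrakk> \<Longrightarrow>
                  ?H j \<le> ?H i \<and> (?H j = ?H i \<longrightarrow> ?X i \<le> ?X j)"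
      unfolding S_def vertex by blast
    have "\<not> i < u" using weight_less[of i u w h] iL uv by fastforce
    moreover have "i \<noteq> u" using uv r by auto
    ultimately have ui: "u < i" by simp
    have iv: "i < v" using weight_mono[of v i h w] uv by fastforce
    \<comment> \<open>The leftmost highest vertex \<open>j\<close> between \<open>u\<close> and
      \<open>v\<close> turns out to be a peak. The condition in \<open>S\<close> then gives it the
      height of \<open>i\<close> and places it not before \<open>i\<close>, so all vertices from
      \<open>u\<close> to \<open>i\<close> are lower.\<close>
    define M where "M = Max (?H ` {u..v})"
    have M: "?H j \<le> M" if "u \<le> j" "j \<le> v" for j using that by (simp add: M_def)
    have "M \<in> ?H ` {u..v}" unfolding M_def using ui iv by (intro Max_in) auto
    then have ex: "\<exists>j. u \<le> j \<and> j \<le> v \<and> ?H j = M" by auto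
    define j where "j = (LEAST j. u \<le> j \<and> j \<le> v \<and> ?H j = M)"
    have j: "u \<le> j" "j \<le> v" "?H j = M" using LeastI_ex[OF ex] by (auto simp: j_def)
    have lt: "?H l < M" if "u \<le> l" "l < j" for l
    proof -
      have "\<not> (u \<le> l \<and> l \<le> v \<and> ?H l = M)" using not_less_Least that(2) unfolding j_def by blast
      then show ?thesis using M[of l] that j by auto
    qed
    have iM: "?H i \<le> M" using M[of i] ui iv by simp
    have uj: "u < j" and jv: "j < v" using j uv iM r by (auto simp: order.strict_iff_order)
    have "?H (j - 1) < ?H j" using lt[of "j - 1"] uj j by simp
    then have up: "rise (w ! (j - 1)) = 1"
      using height_Suc[of "j - 1" w h] uj jv uv by (cases "w ! (j - 1)") auto
    have "?H (Suc j) \<le> ?H j" using M[of "Suc j"] uj jv j by simp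
    then have "w ! j = SouthEast \<or> w ! j = East"
      using height_Suc[of j w h] jv uv by (cases "w ! j") auto
    moreover have "w ! j \<noteq> East" using East[of j] jv uv j iM r nonneg[of u] by fastforce
    ultimately have se: "w ! j = SouthEast" by blast
    then have "j \<in> peaks (h, w)" using up uj jv uv by (simp add: peaks_iff)
    then have "?H j \<le> ?H i \<and> (?H j = ?H i \<longrightarrow> ?X i \<le> ?X j)"
      using pk weight_mono[of u j h w] weight_mono[of j v h w] uj jv by simp
    then have MH: "M = ?H i" and "?X i \<le> ?X j" using j iM by auto
    then have "i \<le> j" using weight_less[of j i w h] se jv uv by fastforce
    then show ?thesis unfolding G_def
      using ui iv uv M lt MH by (intro conjI exI[of _ u] exI[of _ v]) auto
  qed
  have eq: "gap_peak r (rev (map flip (take i w))) (drop i w) \<longleftrightarrow> G r i" if "i \<le> ?L"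
    using gap_peak_iff[OF that, of r h] unfolding G_def .
  show ?thesis
  proof
    assume a: "i \<in> peaks (h, w) \<and> r \<le> relative_height (h, w) i"
    then have i: "0 < i" "i < ?L" "rise (w ! (i - 1)) = 1" "w ! i = SouthEast"
      by (auto simp: peaks_iff)
    have H: "?H i = ?H (i - 1) + 1" "?H (Suc i) = ?H i - 1"
      using i height_Suc[of "i - 1" w h] height_Suc[of i w h] by auto
    \<comment> \<open>The neighbours of a peak show that \<open>S i\<close> is nonempty, so its
      \<open>Max\<close> is attained.\<close>
    have "G 1 i"
    proof (rule GI[of "i - 1" i 1 "Suc i"])
      fix j
      show "?H j < ?H i" if "i - 1 \<le> j" "j < i"
      proof -
        have "j = i - 1" using that by simp
        then show ?thesis using H by simp
      qed
      show "?H j \<le> ?H i" if "i < j" "j \<le> Suc i"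
      proof -
        have "j = Suc i" using that by simp
        then show ?thesis using H by simp
      qed
    qed (use i H in simp_all)
    then have "1 \<in> S i" using GS i by simp
    then have "Max (S i) \<in> S i" using finS by (intro Max_in) auto
    then have GM: "G (relative_height (h, w) i) i" using SG a r rh by simp
    \<comment> \<open>Unlike \<open>S\<close>, which asks for an exact level, \<open>G\<close>
      passes to smaller \<open>r\<close> with the same witnesses.\<close>
    have le: "?H i - relative_height (h, w) i \<le> ?H i - r" using a by simp
    from GM obtain u v where
      "u \<le> i" "?H u \<le> ?H i - relative_height (h, w) i" "\<And>j. \<lbrakk>u \<le> j; j < i\<rbrakk> \<Longrightarrow> ?H j < ?H i"
      "v \<le> ?L" "i \<le> v" "?H v \<le> ?H i - relative_height (h, w) i" "\<And>j. \<lbrakk>i < j; j \<le> v\<rbrakk> \<Longrightarrow> ?H j \<le> ?H i"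
      by (auto simp: G_def)
    then have "G r i" using le by (intro GI[of u i r v]) (auto intro: order_trans)
    then show "i \<le> length w \<and> gap_peak r (rev (map flip (take i w))) (drop i w)"
      using eq i by simp
  next
    assume a: "i \<le> length w \<and> gap_peak r (rev (map flip (take i w))) (drop i w)"
    then have "i \<in> peaks (h, w) \<and> r \<in> S i" using GS eq r by blast
    then show "i \<in> peaks (h, w) \<and> r \<le> relative_height (h, w) i"
      using finS by (simp add: rh)
  qed
qed

lemma card_relative_height:
  assumes "path_word k h w" "1 \<le> r"
  shows "card {i \<in> peaks (h, w). r \<le> relative_height (h, w) i} = peak_count r [] w"
  using relative_height_iff[OF assms] by (simp add: peak_count_eq_card)

section \<open>The counting functions and the two identities\<close>

lemma lattice_path_iff:
  "lattice_path (h, w) \<and> special_conditions k a (h, w) \<longleftrightarrow>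
     h = int k - int a \<and> w \<in> path_words (int k) h \<and>
     (types w \<noteq> [] \<and> hd (types w) \<longrightarrow> descends w \<or> h = 0 \<and> hd w = East)"
proof -
  \<comment> \<open>\<open>hd\<close> of the empty word is unspecified, but a word with a peak is
    not empty.\<close>
  have hd: "hd w = SouthEast \<longleftrightarrow> descends w" if "types w \<noteq> []" using that by (cases w) auto
  have "w \<in> path_words (int k) h \<longleftrightarrow> path_word (int k) h w \<and> (w = [] \<or> last w = SouthEast)"
    using path_word_last by (auto simp: path_words_def)
  moreover have "(\<forall>i. is_leftmost_peak (h, w) i \<and> i \<in> NSE_peaks (h, w) \<longrightarrow>
        hd w = SouthEast \<or> h = 0 \<and> hd w = East) \<longleftrightarrow>
      (types w \<noteq> [] \<and> hd (types w) \<longrightarrow> descends w \<or> h = 0 \<and> hd w = East)"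
    using leftmost_NSE_iff[of h w] hd by blast
  moreover have "(\<forall>i < Suc (length w). 0 \<le> height (h, w) i \<and> height (h, w) i < int k) \<longleftrightarrow>
      (\<forall>i \<le> length w. 0 \<le> height (h, w) i) \<and> (\<forall>i \<le> length w. height (h, w) i < int k)"
    by (auto simp: less_Suc_eq_le)
  ultimately show ?thesis
    unfolding lattice_path_def special_conditions_def path_word_iff fst_conv snd_conv by argo
qed

definition has_peak_counts :: "nat \<Rightarrow> (nat \<Rightarrow> nat) \<Rightarrow> step list \<Rightarrow> bool" where
  "has_peak_counts k N w \<longleftrightarrow> (\<forall>r \<in> {1..k - 1}. peak_count (int r) [] w = N r)"

lemma has_peak_numbers_iff:
  "path_word k' h w \<Longrightarrow> has_peak_numbers k N (h, w) \<longleftrightarrow> has_peak_counts k N w"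
  by (simp add: has_peak_numbers_def has_peak_counts_def card_relative_height)

lemma card_fixed_start: "card {p. fst p = h \<and> P (snd p)} = card {w. P w}"
proof -
  have "{p. fst p = h \<and> P (snd p)} = Pair h ` {w. P w}" by auto
  then show ?thesis by (simp add: card_image inj_on_def)
qed

lemma E_NESE_eq:
  "E_NESE k N a n = card {w \<in> path_words (int k) (int k - int a). types w \<noteq> [] \<and> \<not> hd (types w) \<and>
     maj 0 w = n \<and> has_peak_counts k N w}"
proof -
  let ?P = "\<lambda>w. w \<in> path_words (int k) (int k - int a) \<and> types w \<noteq> [] \<and> \<not> hd (types w) \<and>
     maj 0 w = n \<and> has_peak_counts k N w"
  have "{p. lattice_path p \<and> special_conditions k a p \<and> major_index p = n \<and>
     (\<exists>i. is_leftmost_peak p i \<and> i \<in> NESE_peaks p) \<and> has_peak_numbers k N p}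
    = {p. fst p = int k - int a \<and> ?P (snd p)}"
  proof (rule Collect_cong)
    fix p :: path
    obtain h w where p: "p = (h, w)" by (cases p)
    have "w \<in> path_words (int k) h \<Longrightarrow> has_peak_numbers k N (h, w) \<longleftrightarrow> has_peak_counts k N w"
      using has_peak_numbers_iff[of "int k" h w k N] unfolding path_words_def by blast
    then show "(lattice_path p \<and> special_conditions k a p \<and> major_index p = n \<and>
        (\<exists>i. is_leftmost_peak p i \<and> i \<in> NESE_peaks p) \<and> has_peak_numbers k N p) \<longleftrightarrow>
        fst p = int k - int a \<and> ?P (snd p)"
      unfolding p leftmost_NESE_iff major_index_eq fst_conv snd_conv
      using lattice_path_iff[of h w k a] by blast
  qed
  then show ?thesis unfolding E_NESE_def using card_fixed_start[of "int k - int a" ?P] by simp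
qed

text \<open>By \<open>a < k\<close> the start height is positive, which excludes the East
  alternative of the starting condition.\<close>

lemma E_NSE_eq:
  assumes "a < k"
  shows "E_NSE k N a n = card {w \<in> path_words (int k) (int k - int a). descends w \<and> types w \<noteq> [] \<and>
     hd (types w) \<and> maj 0 w = n \<and> has_peak_counts k N w}"
proof -
  let ?P = "\<lambda>w. w \<in> path_words (int k) (int k - int a) \<and> descends w \<and> types w \<noteq> [] \<and> hd (types w) \<and>
     maj 0 w = n \<and> has_peak_counts k N w"
  have "{p. lattice_path p \<and> special_conditions k a p \<and> major_index p = n \<and>
     (\<exists>i. is_leftmost_peak p i \<and> i \<in> NSE_peaks p) \<and> has_peak_numbers k N p}
    = {p. fst p = int k - int a \<and> ?P (snd p)}"
  proof (rule Collect_cong)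
    fix p :: path
    obtain h w where p: "p = (h, w)" by (cases p)
    have "w \<in> path_words (int k) h \<Longrightarrow> has_peak_numbers k N (h, w) \<longleftrightarrow> has_peak_counts k N w"
      using has_peak_numbers_iff[of "int k" h w k N] unfolding path_words_def by blast
    moreover have "h = int k - int a \<Longrightarrow> h \<noteq> 0" using assms by simp
    ultimately show "(lattice_path p \<and> special_conditions k a p \<and> major_index p = n \<and>
        (\<exists>i. is_leftmost_peak p i \<and> i \<in> NSE_peaks p) \<and> has_peak_numbers k N p) \<longleftrightarrow>
        fst p = int k - int a \<and> ?P (snd p)"
      unfolding p leftmost_NSE_iff major_index_eq fst_conv snd_conv
      using lattice_path_iff[of h w k a] by blast
  qed
  then show ?thesis unfolding E_NSE_def using card_fixed_start[of "int k - int a" ?P] by simp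
qed

lemma bij_betw_card_restrict:
  assumes "bij_betw f A B" "\<And>x. x \<in> A \<Longrightarrow> Q (f x) \<longleftrightarrow> P x"
  shows "card {x \<in> A. P x} = card {y \<in> B. Q y}"
proof (rule bij_betw_same_card)
  show "bij_betw f {x \<in> A. P x} {y \<in> B. Q y}"
    using assms by (auto simp: bij_betw_def inj_on_def)
qed

lemma E_NESE_eq_E_NSE:
  assumes "2 \<le> a" "a \<le> k"
  shows "E_NESE k N a n = E_NSE k N (a - 1) n"
proof -
  let ?s = "int k - int a"
  have s: "int k - int (a - 1) = ?s + 1" and lt: "a - 1 < k" using assms by auto
  have "card {w \<in> {w \<in> path_words (int k) ?s. types w \<noteq> [] \<and> \<not> hd (types w)}.
        maj 0 w = n \<and> has_peak_counts k N w}
      = card {w \<in> {w \<in> path_words (int k) (?s + 1). descends w \<and> types w \<noteq> [] \<and> hd (types w)}.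
        maj 0 w = n \<and> has_peak_counts k N w}"
  proof (rule bij_betw_card_restrict[OF bij_toggle])
    fix w assume w: "w \<in> {w \<in> path_words (int k) ?s. types w \<noteq> [] \<and> \<not> hd (types w)}"
    have "maj 0 (SouthEast # toggle w) = maj 0 w" using w maj_toggle[of w 0] by simp
    moreover have "has_peak_counts k N (SouthEast # toggle w) \<longleftrightarrow> has_peak_counts k N w"
      by (simp add: has_peak_counts_def peak_count_Cons_SE del: peak_count.simps)
    ultimately show "maj 0 (SouthEast # toggle w) = n \<and> has_peak_counts k N (SouthEast # toggle w)
        \<longleftrightarrow> maj 0 w = n \<and> has_peak_counts k N w" by simp
  qed (use assms in simp_all)
  then show ?thesis
    unfolding E_NESE_eq E_NSE_eq[OF lt] s by (simp add: conj_ac)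
qed

text \<open>The shift of the major index in \<open>path_bijection\<close> is a sum of peak counts,
  hence constant on words with prescribed \<open>N r\<close>; preserved types keep the leftmost peak
  an NESE peak.\<close>

lemma E_NESE_shift:
  assumes "1 \<le> k"
  shows "E_NESE k N 1 n = E_NESE k N k (n - (\<Sum>r = 1..k - 1. int (N r)))"
proof -
  obtain m where k: "k = Suc m" using assms by (cases k) auto
  obtain f where f: "bij_betw f (path_words (int (Suc m)) 0) (path_words (int (Suc m)) (int m))"
    and ft: "\<And>w. w \<in> path_words (int (Suc m)) 0 \<Longrightarrow> types (f w) = types w"
    and fc: "\<And>w r. \<lbrakk>w \<in> path_words (int (Suc m)) 0; 1 \<le> r\<rbrakk> \<Longrightarrow>
        peak_count (int r) [] (f w) = peak_count (int r) [] w"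
    and fm: "\<And>w. w \<in> path_words (int (Suc m)) 0 \<Longrightarrow>
        maj 0 (f w) = maj 0 w + (\<Sum>r = 1..m. int (peak_count (int r) [] w))"
    using path_bijection[of m] by metis
  let ?c = "\<Sum>r = 1..m. int (N r)"
  have "card {w \<in> path_words (int (Suc m)) 0. types w \<noteq> [] \<and> \<not> hd (types w) \<and>
        maj 0 w = n - ?c \<and> has_peak_counts k N w}
      = card {w \<in> path_words (int (Suc m)) (int m). types w \<noteq> [] \<and> \<not> hd (types w) \<and>
        maj 0 w = n \<and> has_peak_counts k N w}"
  proof (rule bij_betw_card_restrict[OF f])
    fix w assume w: "w \<in> path_words (int (Suc m)) 0"
    have "has_peak_counts k N (f w) \<longleftrightarrow> has_peak_counts k N w"
      using fc[OF w] by (simp add: has_peak_counts_def)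
    moreover have "maj 0 (f w) = maj 0 w + ?c" if "has_peak_counts k N w"
      using that fm[OF w] by (simp add: has_peak_counts_def k)
    ultimately show "types (f w) \<noteq> [] \<and> \<not> hd (types (f w)) \<and> maj 0 (f w) = n \<and> has_peak_counts k N (f w)
      \<longleftrightarrow> types w \<noteq> [] \<and> \<not> hd (types w) \<and> maj 0 w = n - ?c \<and> has_peak_counts k N w"
      using ft[OF w] by auto
  qed
  then show ?thesis unfolding E_NESE_eq by (simp add: k)
qed

theorem theorem3p2:
  fixes k :: nat and N :: "nat \<Rightarrow> nat"
  assumes "2 \<le> k"
    and "\<forall>r \<in> {1..<k - 1}. N (Suc r) \<le> N r"
  shows "(\<forall>a \<in> {2..k}. \<forall>n :: int. E_NESE k N a n = E_NSE k N (a - 1) n) \<and>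
    (\<forall>n :: int. E_NESE k N 1 n = E_NSE k N (k - 1) (n - (\<Sum>r = 1..k - 1. int (N r))))"
proof (intro conjI allI ballI)
  show "E_NESE k N a n = E_NSE k N (a - 1) n" if "a \<in> {2..k}" for a n
    using that by (intro E_NESE_eq_E_NSE) auto
  show "E_NESE k N 1 n = E_NSE k N (k - 1) (n - (\<Sum>r = 1..k - 1. int (N r)))" for n
    using assms(1) E_NESE_shift[of k N n] E_NESE_eq_E_NSE[of k k N] by simp
qed

end
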